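(* Let $p$ be a symmetric nc polynomial of degree $d$ in $g$ symmetric variables, and let $\widetilde\nu=1+g+\cdots+g^{d-1}$. Suppose $X\in(\mathbb{R}^{n\times n}_{sym})^g$ and $v\in\mathbb{R}^n$. If the set of vectors $\{\widetilde V(X)[H]v:\ H\in(\mathbb{R}^{n\times n}_{sym})^g\}$ has codimension at most $n-1$ in $\mathbb{R}^{ng\widetilde\nu}$ and if the relaxed Hessian of $p$ is positive at $(X,v)$, then $\sigma_-^{min}(p'')=0$, and hence $p$ is convex and has degree at most two.
   Context: An nc polynomial is an element of the free algebra $\mathbb{R}\langle x\rangle$ in noncommuting variables $x_1,\dots,x_g$ with real coefficients. The involution $T$ is the linear map with $x_j^T=x_j$ (and $h_j^T=h_j$) that reverses words; $p$ is symmetric if $p^T=p$. $(\mathbb{R}^{n\times n}_{sym})^g$ is the set of $g$-tuples of real symmetric $n\times n$ matrices, at which nc polynomials are evaluated by substitution. $p'(x)[h]=\frac{d}{dt}p(x+th)|_{t=0}$ and $p''(x)[h]=\frac{d^2}{dt^2}p(x+th)|_{t=0}$ are nc polynomials in the $2g$ variables $x_1,\dots,x_g,h_1,\dots,h_g$. $\widetilde V(x)[h]$ is the column vector of height $g\widetilde\nu$ whose entries are the polynomials $h_jm(x)$, where $1\le j\le g$ and $m$ runs over all words in $x$ of length at most $d-1$ (in some fixed order). Thus $\widetilde V(X)[H]v\in\mathbb{R}^{ng\widetilde\nu}$ is the column of the vectors $H_jm(X)v\in\mathbb{R}^n$; the set of these vectors over all $H$ is a linear subspace. For $\lambda,\delta\in\mathbb{R}$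 the relaxed Hessian is $$p''_{\lambda,\delta}(x)[h]=p''(x)[h]+\delta\,\widetilde V(x)[h]^T\widetilde V(x)[h]+\lambda\,p'(x)[h]^Tp'(x)[h].$$ It is positive at $(X,v)$ if for each $\delta>0$ there is a $\lambda>0$ such that $\langle p''_{\lambda,\delta}(X)[H]v,v\rangle\ge 0$ for all $H\in(\mathbb{R}^{n\times n}_{sym})^g$. For a symmetric nc polynomial $f$, $\sigma_-^{min}(f)$ is the smallest number $\sigma_-$ of negative squares in a representation $f=\sum_{j=1}^{\sigma_+}(f_j^+)^Tf_j^+-\sum_{\ell=1}^{\sigma_-}(f_\ell^-)^Tf_\ell^-$ with nc polynomials $f_j^+,f_\ell^-$; for $f=p''(x)[h]$ these are polynomials in $(x,h)$. A symmetric nc polynomial $p$ is (matrix) convex if $p(tX+(1-t)Y)\preceq tp(X)+(1-t)p(Y)$ for every $n$, all $X,Y\in(\mathbb{R}^{n\times n}_{sym})^g$ and $0\le t\le1$. *)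

theory Defs
  imports "HOL-Analysis.Analysis" "HOL-Analysis.Finite_Function_Topology" "Jordan_Normal_Form.Matrix"
begin

section \<open>Noncommutative polynomials\<close>

text \<open>Words form the free monoid under concatenation. Written additively, this turns the finitely
  supported functions on words, with the convolution product of \<^theory>\<open>HOL-Library.Poly_Mapping\<close>,
  into the free algebra.\<close>

instantiation list :: (type) monoid_add
begin

definition zero_list :: "'a list" where "zero_list = []"

definition plus_list :: "'a list \<Rightarrow> 'a list \<Rightarrow> 'a list" where "plus_list u w = u @ w"

instance by standard (simp_all add: zero_list_def plus_list_def)

end

type_synonym 'x ncpoly = "'x list \<Rightarrow>\<^sub>0 real"

definition nc_word :: "'x list \<Rightarrow> 'x ncpoly" where
  "nc_word w = Poly_Mapping.single w 1"

definition nc_adj :: "'x ncpoly \<Rightarrow> 'x ncpoly" where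
  "nc_adj p = (\<Sum>w\<in>Poly_Mapping.keys p. Poly_Mapping.lookup p w *\<^sub>R nc_word (rev w))"

definition nc_symmetric :: "'x ncpoly \<Rightarrow> bool" where
  "nc_symmetric p \<longleftrightarrow> nc_adj p = p"

text \<open>The zero polynomial gets degree 0.\<close>

definition nc_degree :: "'x ncpoly \<Rightarrow> nat" where
  "nc_degree p = Max (insert 0 (length ` Poly_Mapping.keys p))"

definition nc_subst :: "('x \<Rightarrow> 'y ncpoly) \<Rightarrow> 'x ncpoly \<Rightarrow> 'y ncpoly" where
  "nc_subst f p = (\<Sum>w\<in>Poly_Mapping.keys p. Poly_Mapping.lookup p w *\<^sub>R prod_list (map f w))"

section \<open>Derivatives and the relaxed Hessian\<close>

text \<open>Polynomials in \<open>(x, h)\<close> have variables in \<^typ>\<open>'g + 'g\<close>: \<open>Inl j\<close> stands for \<open>x\<^sub>j\<close> and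
  \<open>Inr j\<close> for \<open>h\<^sub>j\<close>. The derivatives in \<open>t\<close> are those of a curve in the real normed space
  \<^typ>\<open>('g + 'g) ncpoly\<close>, whose norm is the sum of the absolute values of the coefficients.\<close>

definition nc_shift :: "'g ncpoly \<Rightarrow> real \<Rightarrow> ('g + 'g) ncpoly" where
  "nc_shift p t = nc_subst (\<lambda>j. nc_word [Inl j] + t *\<^sub>R nc_word [Inr j]) p"

definition nc_deriv :: "'g ncpoly \<Rightarrow> ('g + 'g) ncpoly" where
  "nc_deriv p = vector_derivative (nc_shift p) (at 0)"

definition nc_hessian :: "'g ncpoly \<Rightarrow> ('g + 'g) ncpoly" where
  "nc_hessian p = vector_derivative (\<lambda>s. vector_derivative (nc_shift p) (at s)) (at 0)"

text \<open>The entries of the column \<open>V\<close>-tilde are indexed by the pairs \<open>(j, m)\<close> themselves rather than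
  by their positions in an enumeration. Length at most \<open>d - 1\<close> is rendered as length \<open>< d\<close>, so
  that the column is empty for \<open>d = 0\<close>.\<close>

definition Vt_index :: "nat \<Rightarrow> ('g \<times> 'g list) set" where
  "Vt_index d = UNIV \<times> {m. length m < d}"

definition Vt_entry :: "'g \<Rightarrow> 'g list \<Rightarrow> ('g + 'g) ncpoly" where
  "Vt_entry j m = nc_word (Inr j # map Inl m)"

text \<open>The parameter \<open>r\<close> is the multiplier usually written \<open>\<lambda>\<close>.\<close>

definition relaxed_hessian :: "'g::finite ncpoly \<Rightarrow> real \<Rightarrow> real \<Rightarrow> ('g + 'g) ncpoly" where
  "relaxed_hessian p r \<delta> =
     nc_hessian p
     + \<delta> *\<^sub>R (\<Sum>(j, m)\<in>Vt_index (nc_degree p). nc_adj (Vt_entry j m) * Vt_entry j m)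
     + r *\<^sub>R (nc_adj (nc_deriv p) * nc_deriv p)"

section \<open>Evaluation at tuples of symmetric matrices\<close>

definition sym_tuples :: "nat \<Rightarrow> ('g \<Rightarrow> real Matrix.mat) set" where
  "sym_tuples n = {X. \<forall>j. X j \<in> carrier_mat n n \<and> transpose_mat (X j) = X j}"

definition eval_word :: "nat \<Rightarrow> ('x \<Rightarrow> real Matrix.mat) \<Rightarrow> 'x list \<Rightarrow> real Matrix.mat" where
  "eval_word n X w = foldr (\<lambda>j M. X j * M) w (1\<^sub>m n)"

text \<open>The linear combination of the matrices \<open>eval_word n X w\<close> is formed entrywise, because
  \<^typ>\<open>real Matrix.mat\<close> comprises all matrix sizes and hence has no zero to start a sum from.\<close>

definition nc_eval :: "nat \<Rightarrow> ('x \<Rightarrow> real Matrix.mat) \<Rightarrow> 'x ncpoly \<Rightarrow> real Matrix.mat" where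
  "nc_eval n X p = Matrix.mat n n (\<lambda>(i, k).
     \<Sum>w\<in>Poly_Mapping.keys p. Poly_Mapping.lookup p w * eval_word n X w $$ (i, k))"

text \<open>The joint tuple \<open>(X, H)\<close> is \<open>case_sum X H\<close>. The vector \<open>V\<close>-tilde\<open>(X)[H]v\<close> has as its
  coordinate \<open>(j, m, i)\<close> the \<open>i\<close>-th entry of \<open>H\<^sub>j m(X) v\<close>; with \<open>d\<close> the degree, it lives in the
  space of functions supported on the \<open>n g (1 + g + \<dots> + g\<^bsup>d-1\<^esup>)\<close> many triples
  with \<open>length m < d\<close> and \<open>i < n\<close>.\<close>

definition Vt_vec :: "nat \<Rightarrow> nat \<Rightarrow> ('g::finite \<Rightarrow> real Matrix.mat) \<Rightarrow> ('g \<Rightarrow> real Matrix.mat)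
    \<Rightarrow> real Matrix.vec \<Rightarrow> ('g \<times> 'g list \<times> nat) \<Rightarrow>\<^sub>0 real" where
  "Vt_vec n d X H v = (\<Sum>(j, m)\<in>Vt_index d. \<Sum>i<n.
     Poly_Mapping.single (j, m, i)
       (vec_index (nc_eval n (case_sum X H) (Vt_entry j m) *\<^sub>v v) i))"

definition relaxed_hessian_positive ::
    "nat \<Rightarrow> 'g::finite ncpoly \<Rightarrow> ('g \<Rightarrow> real Matrix.mat) \<Rightarrow> real Matrix.vec \<Rightarrow> bool" where
  "relaxed_hessian_positive n p X v \<longleftrightarrow>
     (\<forall>\<delta>>0. \<exists>r>0. \<forall>H\<in>sym_tuples n.
        scalar_prod (nc_eval n (case_sum X H) (relaxed_hessian p r \<delta>) *\<^sub>v v) v \<ge> 0)"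

section \<open>Negative squares and convexity\<close>

definition sos_difference :: "'x ncpoly \<Rightarrow> 'x ncpoly list \<Rightarrow> 'x ncpoly list \<Rightarrow> bool" where
  "sos_difference f ps ns \<longleftrightarrow> f = (\<Sum>q\<leftarrow>ps. nc_adj q * q) - (\<Sum>q\<leftarrow>ns. nc_adj q * q)"

text \<open>For symmetric \<open>f\<close> the minimum is over a nonempty set, since \<open>f\<close> is the difference of the
  squares of \<open>(1 + f)/2\<close> and \<open>(1 - f)/2\<close>.\<close>

definition sigma_minus_min :: "'x ncpoly \<Rightarrow> nat" where
  "sigma_minus_min f = (LEAST k. \<exists>ps ns. sos_difference f ps ns \<and> length ns = k)"

definition loewner_le :: "nat \<Rightarrow> real Matrix.mat \<Rightarrow> real Matrix.mat \<Rightarrow> bool" where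
  "loewner_le n A B \<longleftrightarrow> (\<forall>u\<in>carrier_vec n. scalar_prod ((B - A) *\<^sub>v u) u \<ge> 0)"

definition nc_convex :: "'g ncpoly \<Rightarrow> bool" where
  "nc_convex p \<longleftrightarrow> (\<forall>n. \<forall>X\<in>sym_tuples n. \<forall>Y\<in>sym_tuples n. \<forall>t\<in>{0..1}.
     loewner_le n
       (nc_eval n (\<lambda>j. t \<cdot>\<^sub>m X j + (1 - t) \<cdot>\<^sub>m Y j) p)
       (t \<cdot>\<^sub>m nc_eval n X p + (1 - t) \<cdot>\<^sub>m nc_eval n Y p))"

end

theory Submission
  imports Defs
begin

text \<open>Let \<open>S\<close> be the space of all \<open>V\<close>-tilde\<open>(X)[H]v\<close>, and let \<open>\<alpha>\<close> assign a real number to every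
  pair \<open>(j, m)\<close> with \<open>length m \<le> d - 2\<close>. For \<open>b\<close> in \<open>\<real>\<^sup>n\<close> take the vector with blocks \<open>\<alpha> j m \<cdot> b\<close>
  for these pairs. The vector \<open>p'(X)[H]v\<close> is a linear function of \<open>V\<close>-tilde\<open>(X)[H]v\<close> in which the block
  of a word \<open>j # m\<close> of top degree \<open>d\<close> enters with the scalar factor \<open>p\<^bsub>j # m\<^esub>\<close>; so one block of
  top length can be chosen, linearly in \<open>b\<close>, to make this function vanish. These vectors form the
  image of an \<open>n\<close>-dimensional space, whereas \<open>S\<close> has codimension less than \<open>n\<close>, so for some
  \<open>b \<noteq> 0\<close> the vector lies in \<open>S\<close>. For the corresponding \<open>H\<close> the term with
  \<open>\<lambda>\<close> is zero, and \<open>\<delta> \<rightarrow> 0\<close> gives \<open>\<langle>p''(X)[H]v, v\<rangle> \<ge> 0\<close>, where \<open>\<langle>p''(X)[H]v, v\<rangle>\<close> is an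
  explicit quadratic expression in \<open>\<alpha>\<close> and \<open>b\<close>.

  If \<open>d \<ge> 3\<close>, split a word of degree \<open>d\<close> as \<open>k # j # m\<close>. The block of the middle matrix of \<open>p''\<close>
  at \<open>(j, m)\<close>, \<open>(j, m)\<close> is zero for reasons of degree, while the one at \<open>(k, [])\<close>, \<open>(j, m)\<close> is a
  nonzero scalar. Hence some \<open>\<alpha>\<close> makes the expression negative for all \<open>b \<noteq> 0\<close>, a contradiction.
  If \<open>d \<le> 2\<close>, the expression shows that the matrix of the coefficients \<open>p\<^bsub>[j, k]\<^esub>\<close> is positive
  semidefinite, which makes \<open>p''\<close> a sum of squares and \<open>p\<close> convex.\<close>

no_notation vec_nth (infixl "$" 90) and inner (infix "\<bullet>" 70)

section \<open>Linear algebra\<close>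

text \<open>Coefficients are attached to indices instead of vectors, so \<open>f\<close> may repeat
  values.\<close>

lemma span_image_lessThanD:
  assumes "y \<in> span (f ` {..<k::nat})"
  shows "\<exists>c. y = (\<Sum>i<k. c i *\<^sub>R f i)"
  using assms
proof (induction k arbitrary: y)
  case 0
  then show ?case by simp
next
  case (Suc k)
  then obtain r where "y - r *\<^sub>R f k \<in> span (f ` {..<k})"
    by (auto simp: lessThan_Suc span_breakdown_eq)
  with Suc.IH obtain c where c: "y - r *\<^sub>R f k = (\<Sum>i<k. c i *\<^sub>R f i)"
    by blast
  then have "y = (\<Sum>i<Suc k. (c(k := r)) i *\<^sub>R f i)"
    by (simp add: algebra_simps)
  then show ?case by blast
qed

text \<open>Otherwise a basis of \<open>S\<close> together with all the \<open>f k\<close> would be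
  an independent set of \<open>dim S + n\<close> vectors in the span of \<open>T\<close>, which is
  more than \<open>card T\<close> allows.\<close>

lemma subspace_contains_combination:
  fixes S :: "'b::real_vector set"
  assumes S: "subspace S" and T: "finite T" "S \<subseteq> span T" "\<And>k. k < n \<Longrightarrow> f k \<in> span T"
    and card: "card T < dim S + n"
  shows "\<exists>b. (\<exists>k<n. b k \<noteq> 0) \<and> (\<Sum>k<n. b k *\<^sub>R f k) \<in> S"
proof (rule ccontr)
  assume neg: "\<not> ?thesis"
  obtain B where B: "B \<subseteq> S" "independent B" "S \<subseteq> span B" "card B = dim S"
    using basis_exists by blast
  have span_B: "span B = S"
    using B S by (metis span_minimal subset_antisym)
  have fin_B: "finite B"
    using independent_span_bound[OF T(1) B(2)] B(1) T(2) by blast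
  \<comment> \<open>The cardinality is carried along in the induction because \<open>f\<close> is
    not assumed injective.\<close>
  have "independent (B \<union> f ` {..<k}) \<and> card (B \<union> f ` {..<k}) = card B + k" if "k \<le> n" for k
    using that
  proof (induction k)
    case 0
    then show ?case using B by simp
  next
    case (Suc k)
    have notin: "f k \<notin> span (B \<union> f ` {..<k})"
    proof
      assume "f k \<in> span (B \<union> f ` {..<k})"
      then obtain x y where xy: "f k = x + y" "x \<in> S" "y \<in> span (f ` {..<k})"
        by (auto simp: span_Un span_B)
      from span_image_lessThanD[OF xy(3)] obtain c where c: "y = (\<Sum>i<k. c i *\<^sub>R f i)"
        by blast
      define b where "b i = (if i = k then 1 else if i < k then - c i else 0)" for i
      have "(\<Sum>i<n. b i *\<^sub>R f i) = (\<Sum>i<Suc k. b i *\<^sub>R f i)"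
        using Suc.prems by (intro sum.mono_neutral_right) (auto simp: b_def)
      also have "\<dots> = f k - y"
        by (simp add: b_def c sum_negf)
      finally have "(\<Sum>i<n. b i *\<^sub>R f i) \<in> S"
        using xy by simp
      moreover have "k < n" "b k \<noteq> 0"
        using Suc.prems by (auto simp: b_def)
      ultimately show False
        using neg by blast
    qed
    have eq: "B \<union> f ` {..<Suc k} = insert (f k) (B \<union> f ` {..<k})"
      by (auto simp: lessThan_Suc)
    have "f k \<notin> B \<union> f ` {..<k}"
      using notin span_base[of "f k" "B \<union> f ` {..<k}"] by argo
    then show ?case
      unfolding eq using Suc.IH Suc.prems notin fin_B by (simp add: independent_insertI del: Un_iff)
  qed
  then have "independent (B \<union> f ` {..<n})" "card (B \<union> f ` {..<n}) = dim S + n"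
    using B by auto
  moreover have "B \<union> f ` {..<n} \<subseteq> span T"
    using B(1) T by auto
  ultimately show False
    using independent_span_bound[OF T(1), of "B \<union> f ` {..<n}"] card by simp
qed

text \<open>Completing the square in the variable \<open>a\<close>: removing the rank-one form built
  from the row of \<open>a\<close> leaves the Schur complement, a nonnegative form in the remaining
  variables, to which the induction hypothesis applies.\<close>

lemma psd_form_eq_sum_squares:
  fixes P :: "'a \<Rightarrow> 'a \<Rightarrow> real"
  assumes "finite A" and "\<And>i j. P i j = P j i"
    and "\<And>x. (\<Sum>i\<in>A. \<Sum>j\<in>A. P i j * x i * x j) \<ge> 0"
  shows "\<exists>cs. \<forall>i\<in>A. \<forall>j\<in>A. P i j = (\<Sum>c\<leftarrow>cs. c i * c j)"
  using assms
proof (induction A arbitrary: P)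
  case empty
  then show ?case by simp
next
  case (insert a A)
  note sym = insert.prems(1)
  have expand: "(\<Sum>i\<in>insert a A. \<Sum>j\<in>insert a A. P i j * x i * x j)
      = P a a * (x a)\<^sup>2 + 2 * x a * (\<Sum>j\<in>A. P a j * x j) + (\<Sum>i\<in>A. \<Sum>j\<in>A. P i j * x i * x j)" for x
  proof -
    have "(\<Sum>i\<in>A. P i a * x i * x a) = x a * (\<Sum>j\<in>A. P a j * x j)"
      "(\<Sum>j\<in>A. P a j * x a * x j) = x a * (\<Sum>j\<in>A. P a j * x j)"
      by (auto simp: sum_distrib_left sym[of _ a] mult_ac intro!: sum.cong)
    then show ?thesis
      using insert.hyps by (simp add: sum.distrib power2_eq_square)
  qed
  have P_aa: "P a a \<ge> 0"
  proof -
    have "(\<Sum>j\<in>A. P a j * (if j = a then 1 else 0)) = 0"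
      "(\<Sum>i\<in>A. \<Sum>j\<in>A. P i j * (if i = a then 1 else 0) * (if j = a then 1 else 0)) = 0"
      using insert.hyps by (auto intro!: sum.neutral)
    then show ?thesis
      using insert.prems(2)[of "\<lambda>i. if i = a then 1 else 0"] unfolding expand by simp
  qed
  have row0: "P a k = 0" if "P a a = 0" "k \<in> A" for k
  proof (rule ccontr)
    assume nz: "P a k \<noteq> 0"
    \<comment> \<open>With \<open>x k = 1\<close>, this value at \<open>a\<close> makes the whole
      form equal to -1.\<close>
    define x where "x i = (if i = a then - (P k k + 1) / (2 * P a k) else if i = k then 1 else 0)" for i
    have "(\<Sum>j\<in>A. P a j * x j) = (\<Sum>j\<in>A. if j = k then P a k else 0)"
      using insert.hyps by (intro sum.cong) (auto simp: x_def)
    moreover have "(\<Sum>i\<in>A. \<Sum>j\<in>A. P i j * x i * x j) = (\<Sum>i\<in>A. \<Sum>j\<in>A. if j = k then if i = k then P k k else 0 else 0)"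
      using insert.hyps by (intro sum.cong) (auto simp: x_def)
    ultimately have "2 * x a * P a k + P k k \<ge> 0"
      using insert.prems(2)[of x] insert.hyps that unfolding expand by simp
    then show False
      using nz by (simp add: x_def field_simps)
  qed
  \<comment> \<open>For \<open>P a a = 0\<close>, division by zero gives \<open>c0 = 0\<close>, so
    nothing is subtracted; by \<open>row0\<close> the row of \<open>a\<close> is then zero
    anyway.\<close>
  define c0 where "c0 j = P a j / sqrt (P a a)" for j
  define P' where "P' i j = P i j - c0 i * c0 j" for i j
  have c0: "c0 i * c0 j = P a i * P a j / P a a" for i j
    using P_aa by (simp add: c0_def)
  have "(\<Sum>i\<in>A. \<Sum>j\<in>A. P' i j * x i * x j) \<ge> 0" for x
  proof -
    define s where "s = (\<Sum>j\<in>A. P a j * x j)"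
    \<comment> \<open>For \<open>P a a > 0\<close> this value at \<open>a\<close> minimises the form
      with the other coordinates fixed, and the minimum is the form of \<open>P'\<close>.\<close>
    define y where "y = x(a := - s / P a a)"
    have y: "(\<Sum>j\<in>A. P a j * y j) = s" "(\<Sum>i\<in>A. \<Sum>j\<in>A. P i j * y i * y j) = (\<Sum>i\<in>A. \<Sum>j\<in>A. P i j * x i * x j)"
      unfolding s_def using insert.hyps by (auto simp: y_def intro!: sum.cong)
    have "s * s / P a a = (\<Sum>i\<in>A. \<Sum>j\<in>A. c0 i * c0 j * x i * x j)"
      by (simp add: s_def c0 sum_product sum_divide_distrib mult_ac)
    then have "(\<Sum>i\<in>A. \<Sum>j\<in>A. P' i j * x i * x j) = (\<Sum>i\<in>A. \<Sum>j\<in>A. P i j * x i * x j) - s * s / P a a"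
      by (simp add: P'_def left_diff_distrib sum_subtractf)
    moreover have "P a a * (y a)\<^sup>2 + 2 * y a * s = - (s * s / P a a)"
      by (cases "P a a = 0") (auto simp: y_def power2_eq_square field_simps)
    ultimately show ?thesis
      using insert.prems(2)[of y] unfolding expand y by linarith
  qed
  moreover have "P' i j = P' j i" for i j
    using sym by (simp add: P'_def mult_ac)
  ultimately obtain cs where cs: "\<forall>i\<in>A. \<forall>j\<in>A. P' i j = (\<Sum>c\<leftarrow>cs. c i * c j)"
    using insert.IH[of P'] by blast
  \<comment> \<open>The functions in \<open>cs\<close> represent \<open>P'\<close> on
    \<open>A\<close> only. They are set to zero at \<open>a\<close>, since \<open>c0\<close> alone
    accounts for that row and column.\<close>
  define ds where "ds = c0 # map (\<lambda>c. c(a := 0)) cs"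
  have row: "P a j = c0 a * c0 j" if "j \<in> insert a A" for j
    using that row0[of j] unfolding c0 by (cases "P a a = 0") auto
  have "P i j = (\<Sum>c\<leftarrow>ds. c i * c j)" if ij: "i \<in> insert a A" "j \<in> insert a A" for i j
  proof -
    consider "i = a" | "j = a" | "i \<in> A" "j \<in> A" "i \<noteq> a" "j \<noteq> a"
      using ij insert.hyps by blast
    then show ?thesis
    proof cases
      case 1
      then show ?thesis using row ij by (simp add: ds_def o_def)
    next
      case 2
      then show ?thesis using row ij sym[of i j] by (simp add: ds_def o_def)
    next
      case 3
      then show ?thesis using cs by (simp add: ds_def o_def P'_def algebra_simps)
    qed
  qed
  then show ?case by blast
qed

section \<open>Linear extension from words\<close>

text \<open>The adjoint, both derivatives and the coordinates of evaluations are all linear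
  extensions of this kind, so identities between them can be checked on words.\<close>

definition nc_ext :: "('a \<Rightarrow> 'b::real_vector) \<Rightarrow> ('a \<Rightarrow>\<^sub>0 real) \<Rightarrow> 'b" where
  "nc_ext f p = (\<Sum>w\<in>Poly_Mapping.keys p. Poly_Mapping.lookup p w *\<^sub>R f w)"

lemma lookup_scaleR [simp]:
  "Poly_Mapping.lookup (c *\<^sub>R p) w = c *\<^sub>R Poly_Mapping.lookup p w"
proof -
  have "finite {i. c *\<^sub>R Poly_Mapping.lookup p i \<noteq> 0}"
    by (rule finite_subset[OF _ finite_keys[of p]]) (auto simp: in_keys_iff)
  then show ?thesis
    by (simp add: scaleR_poly_mapping_def)
qed

lemma nc_ext_superset:
  assumes "finite A" "Poly_Mapping.keys p \<subseteq> A"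
  shows "nc_ext f p = (\<Sum>w\<in>A. Poly_Mapping.lookup p w *\<^sub>R f w)"
  unfolding nc_ext_def using assms
  by (intro sum.mono_neutral_left) (auto simp: in_keys_iff)

lemma linear_nc_ext: "linear (nc_ext f)"
proof
  fix p q :: "'a \<Rightarrow>\<^sub>0 real" and c :: real
  have "nc_ext f r = (\<Sum>w\<in>Poly_Mapping.keys p \<union> Poly_Mapping.keys q. Poly_Mapping.lookup r w *\<^sub>R f w)"
    if "r \<in> {p, q, p + q}" for r
    using that keys_add[of p q] by (intro nc_ext_superset) auto
  then show "nc_ext f (p + q) = nc_ext f p + nc_ext f q"
    by (simp add: lookup_add scaleR_add_left sum.distrib)
  have "nc_ext f (c *\<^sub>R p) = (\<Sum>w\<in>Poly_Mapping.keys p. Poly_Mapping.lookup (c *\<^sub>R p) w *\<^sub>R f w)"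
    by (intro nc_ext_superset) (auto simp: in_keys_iff)
  then show "nc_ext f (c *\<^sub>R p) = c *\<^sub>R nc_ext f p"
    by (simp add: nc_ext_def scaleR_sum_right)
qed

lemmas nc_ext_add = linear_add[OF linear_nc_ext]
  and nc_ext_scaleR = linear_scale[OF linear_nc_ext]
  and nc_ext_sum = linear_sum[OF linear_nc_ext]

lemma nc_ext_single [simp]: "nc_ext f (Poly_Mapping.single w c) = c *\<^sub>R f w"
  by (cases "c = 0") (simp_all add: nc_ext_def)

lemma nc_ext_word [simp]: "nc_ext f (nc_word w) = f w"
  by (simp add: nc_word_def)

lemma nc_ext_nc_word: "nc_ext nc_word p = p"
proof (rule poly_mapping_eqI)
  fix k
  show "Poly_Mapping.lookup (nc_ext nc_word p) k = Poly_Mapping.lookup p k"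
    by (cases "k \<in> Poly_Mapping.keys p")
      (auto simp: nc_ext_def lookup_sum nc_word_def lookup_single when_def in_keys_iff
        if_distrib sum.delta cong: if_cong)
qed

lemma linear_eq_nc_ext:
  assumes "linear F"
  shows "F p = nc_ext (\<lambda>w. F (nc_word w)) p"
proof -
  have "F p = F (nc_ext nc_word p)"
    by (simp add: nc_ext_nc_word)
  also have "\<dots> = nc_ext (\<lambda>w. F (nc_word w)) p"
    by (simp add: nc_ext_def linear_sum[OF assms] linear_scale[OF assms])
  finally show ?thesis .
qed

lemma linear_eq_on_words:
  assumes "linear F" "linear G" "\<And>w. F (nc_word w) = G (nc_word w)"
  shows "F p = G p"
  by (subst (1 2) linear_eq_nc_ext) (use assms in auto)

lemma nc_adj_eq_ext: "nc_adj = nc_ext (\<lambda>w. nc_word (rev w))"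
  by (simp add: fun_eq_iff nc_adj_def nc_ext_def)

lemma linear_nc_adj: "linear nc_adj"
  by (simp add: nc_adj_eq_ext linear_nc_ext)

lemma nc_adj_word [simp]: "nc_adj (nc_word w) = nc_word (rev w)"
  by (simp add: nc_adj_eq_ext)

text \<open>Links the pointwise scaling to the convolution product: scaling is multiplication, from
  either side, by a constant polynomial. The monoid element \<open>0\<close> is the empty
  word.\<close>

lemma scaleR_eq_single_mult:
  fixes p :: "'x ncpoly"
  shows "c *\<^sub>R p = Poly_Mapping.single 0 c * p" "c *\<^sub>R p = p * Poly_Mapping.single 0 c"
proof -
  have s: "Poly_Mapping.single 0 c * (r *\<^sub>R Poly_Mapping.single w a) = Poly_Mapping.single w (c * (r * a))"
    "(r *\<^sub>R Poly_Mapping.single w a) * Poly_Mapping.single 0 c = Poly_Mapping.single w (c * (r * a))"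
    for r a :: real and w :: "'x list"
  proof -
    have "r *\<^sub>R Poly_Mapping.single w a = Poly_Mapping.single w (r * a)"
      by (rule poly_mapping_eqI) (simp add: lookup_single when_def)
    then show "Poly_Mapping.single 0 c * (r *\<^sub>R Poly_Mapping.single w a) = Poly_Mapping.single w (c * (r * a))"
      "(r *\<^sub>R Poly_Mapping.single w a) * Poly_Mapping.single 0 c = Poly_Mapping.single w (c * (r * a))"
      by (simp_all add: mult_single mult_ac)
  qed
  have sc: "c *\<^sub>R (r *\<^sub>R Poly_Mapping.single w a) = Poly_Mapping.single w (c * (r * a))"
    for r a :: real and w :: "'x list"
    by (rule poly_mapping_eqI) (simp add: lookup_single when_def)
  have p: "p = (\<Sum>w\<in>Poly_Mapping.keys p. Poly_Mapping.lookup p w *\<^sub>R Poly_Mapping.single w 1)"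
    using nc_ext_nc_word[of p] by (simp add: nc_ext_def nc_word_def)
  define q where "q = (\<Sum>w\<in>Poly_Mapping.keys p. Poly_Mapping.lookup p w *\<^sub>R Poly_Mapping.single w (1::real))"
  have "c *\<^sub>R q = Poly_Mapping.single 0 c * q" "c *\<^sub>R q = q * Poly_Mapping.single 0 c"
    by (simp_all only: q_def sum_distrib_left sum_distrib_right scaleR_sum_right s sc)
  then show "c *\<^sub>R p = Poly_Mapping.single 0 c * p" "c *\<^sub>R p = p * Poly_Mapping.single 0 c"
    using p by (simp_all only: q_def)
qed

lemma scaleR_mult_ncpoly:
  fixes p q :: "'x ncpoly"
  shows "(c *\<^sub>R p) * q = c *\<^sub>R (p * q)" "p * (c *\<^sub>R q) = c *\<^sub>R (p * q)"
  by (simp_all only: scaleR_eq_single_mult(1)[of c p] scaleR_eq_single_mult(1)[of c "p * q"] mult.assoc,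
      simp only: scaleR_eq_single_mult(2)[of c] scaleR_eq_single_mult(1)[of c "p * q", symmetric] mult.assoc)

lemma linear_mult_ncpoly:
  fixes p :: "'x ncpoly"
  shows "linear (\<lambda>q. p * q)" "linear (\<lambda>q. q * p)"
  by (rule linearI; simp add: algebra_simps scaleR_mult_ncpoly)+

lemma nc_word_mult: "nc_word u * nc_word w = nc_word (u @ w)"
  by (simp add: nc_word_def mult_single plus_list_def)

lemma nc_word_Nil: "nc_word [] = 1"
  by (simp add: nc_word_def zero_list_def flip: single_one)

section \<open>Degree, coefficients and symmetry\<close>

lemma nc_degree_le_iff:
  "nc_degree p \<le> k \<longleftrightarrow> (\<forall>w\<in>Poly_Mapping.keys p. length w \<le> k)"
  by (auto simp: nc_degree_def)

lemma lookup_eq_0_above_degree: "nc_degree p < length w \<Longrightarrow> Poly_Mapping.lookup p w = 0"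
  using nc_degree_le_iff[of p "nc_degree p"] by (subst not_in_keys_iff_lookup_eq_zero[symmetric]) force

lemma ex_word_of_degree:
  assumes "nc_degree p > 0"
  obtains w where "w \<in> Poly_Mapping.keys p" "length w = nc_degree p"
proof -
  have "nc_degree p \<in> insert 0 (length ` Poly_Mapping.keys p)"
    unfolding nc_degree_def by (rule Max_in) auto
  then show ?thesis using assms that by auto
qed

lemma lookup_nc_adj: "Poly_Mapping.lookup (nc_adj p) w = Poly_Mapping.lookup p (rev w)"
proof -
  have l: "linear (\<lambda>p :: 'a ncpoly. Poly_Mapping.lookup p w)" for w :: "'a list"
    by (rule linearI) (simp_all add: lookup_add)
  have "(Poly_Mapping.lookup (nc_adj p) w :: real) = Poly_Mapping.lookup p (rev w)"
    by (rule linear_eq_on_words[OF linear_compose[OF linear_nc_adj l, unfolded o_def] l],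
        unfold nc_adj_word) (auto simp: nc_word_def lookup_single when_def)
  then show ?thesis .
qed

lemma nc_symmetricD: "nc_symmetric p \<Longrightarrow> Poly_Mapping.lookup p (rev w) = Poly_Mapping.lookup p w"
  by (metis lookup_nc_adj nc_symmetric_def)

section \<open>Derivatives of noncommutative polynomials\<close>

text \<open>A decomposition marks one letter of \<open>w\<close>, the one that the product rule
  replaces by its \<open>h\<close>-variable; \<open>splits2\<close> marks two letters in their order
  of occurrence.\<close>

definition splits1 :: "'x list \<Rightarrow> ('x list \<times> 'x \<times> 'x list) set" where
  "splits1 w = {(a, j, m). w = a @ j # m}"

definition splits2 :: "'x list \<Rightarrow> ('x list \<times> 'x \<times> 'x list \<times> 'x \<times> 'x list) set" where
  "splits2 w = {(a, j, u, k, m). w = a @ j # u @ k # m}"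

lemma splits1_Nil [simp]: "splits1 [] = {}"
  and splits2_Nil [simp]: "splits2 [] = {}"
  by (auto simp: splits1_def splits2_def)

lemma splits1_Cons:
  "splits1 (x # w) = insert ([], x, w) ((\<lambda>(a, j, m). (x # a, j, m)) ` splits1 w)"
  by (auto simp: splits1_def Cons_eq_append_conv image_iff)

lemma splits2_Cons:
  "splits2 (x # w) = (\<lambda>(u, k, m). ([], x, u, k, m)) ` splits1 w
     \<union> (\<lambda>(a, j, u, k, m). (x # a, j, u, k, m)) ` splits2 w"
  by (auto simp: splits1_def splits2_def Cons_eq_append_conv image_iff)

lemma finite_splits1 [simp]: "finite (splits1 w)"
  by (induction w) (simp_all add: splits1_Cons)

lemma finite_splits2 [simp]: "finite (splits2 w)"
  by (induction w) (simp_all add: splits2_Cons)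

lemma sum_splits1_Cons:
  "(\<Sum>(a, j, m)\<in>splits1 (x # w). f a j m) = f [] x w + (\<Sum>(a, j, m)\<in>splits1 w. f (x # a) j m)"
proof -
  have "inj_on (\<lambda>(a, j, m). (x # a, j, m)) (splits1 w)"
    by (auto simp: inj_on_def)
  then show ?thesis
    by (subst splits1_Cons, subst sum.insert)
      (auto simp: sum.reindex case_prod_unfold o_def)
qed

lemma sum_splits2_Cons:
  "(\<Sum>(a, j, u, k, m)\<in>splits2 (x # w). f a j u k m)
     = (\<Sum>(u, k, m)\<in>splits1 w. f [] x u k m) + (\<Sum>(a, j, u, k, m)\<in>splits2 w. f (x # a) j u k m)"
proof -
  have "inj_on (\<lambda>(a, j, u, k, m). (x # a, j, u, k, m)) (splits2 w)"
    "inj_on (\<lambda>(u, k, m). ([], x, u, k, m)) (splits1 w)"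
    by (auto simp: inj_on_def)
  then show ?thesis
    by (subst splits2_Cons, subst sum.union_disjoint)
      (auto simp: sum.reindex case_prod_unfold o_def inj_on_def)
qed

definition word_deriv :: "'g list \<Rightarrow> ('g + 'g) ncpoly" where
  "word_deriv w = (\<Sum>(a, j, m)\<in>splits1 w. nc_word (map Inl a @ Inr j # map Inl m))"

text \<open>Each pair of positions is counted once, so this is the coefficient of
  \<open>t\<^sup>2\<close>, half of the second derivative.\<close>

definition word_deriv2 :: "'g list \<Rightarrow> ('g + 'g) ncpoly" where
  "word_deriv2 w = (\<Sum>(a, j, u, k, m)\<in>splits2 w.
     nc_word (map Inl a @ Inr j # map Inl u @ Inr k # map Inl m))"

lemma word_deriv_Nil [simp]: "word_deriv [] = 0"
  and word_deriv2_Nil [simp]: "word_deriv2 [] = 0"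
  by (simp_all add: word_deriv_def word_deriv2_def)

lemma word_deriv_Cons:
  "word_deriv (x # w) = nc_word (Inr x # map Inl w) + nc_word [Inl x] * word_deriv w"
  unfolding word_deriv_def sum_splits1_Cons
  by (simp add: sum_distrib_left nc_word_mult case_prod_unfold)

lemma word_deriv2_Cons:
  "word_deriv2 (x # w) = nc_word [Inr x] * word_deriv w + nc_word [Inl x] * word_deriv2 w"
  unfolding word_deriv2_def word_deriv_def sum_splits2_Cons
  by (simp add: sum_distrib_left nc_word_mult case_prod_unfold)

text \<open>Derivatives at 0 up to the second order need only the coefficients up to
  \<open>t\<^sup>2\<close>. The rest stays an unspecified finite sum of powers of exponent at least
  3.\<close>

lemma prod_shift_expand:
  "\<exists>R. \<forall>t. prod_list (map (\<lambda>j. nc_word [Inl j] + t *\<^sub>R nc_word [Inr j]) w)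
     = nc_word (map Inl w) + t *\<^sub>R word_deriv w + t\<^sup>2 *\<^sub>R word_deriv2 w
       + (\<Sum>i<length w. t ^ (i + 3) *\<^sub>R R i)"
proof (induction w)
  case Nil
  then show ?case by (simp add: nc_word_Nil)
next
  case (Cons x w)
  then obtain R where R: "prod_list (map (\<lambda>j. nc_word [Inl j] + t *\<^sub>R nc_word [Inr j]) w)
     = nc_word (map Inl w) + t *\<^sub>R word_deriv w + t\<^sup>2 *\<^sub>R word_deriv2 w
       + (\<Sum>i<length w. t ^ (i + 3) *\<^sub>R R i)" for t by blast
  define X H where "X = (nc_word [Inl x] :: ('a + 'a) ncpoly)" and "H = (nc_word [Inr x] :: ('a + 'a) ncpoly)"
  \<comment> \<open>The factor \<open>X\<close> keeps the exponent and \<open>t *\<^sub>R H\<close>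
    raises it by one, so the former coefficient of \<open>t\<^sup>2\<close> enters the remainder at
    \<open>i = 0\<close>.\<close>
  define R' where "R' i = (if i < length w then X * R i else 0)
     + (if i = 0 then H * word_deriv2 w else H * R (i - 1))" for i
  have "prod_list (map (\<lambda>j. nc_word [Inl j] + t *\<^sub>R nc_word [Inr j]) (x # w))
    = nc_word (map Inl (x # w)) + t *\<^sub>R word_deriv (x # w) + t\<^sup>2 *\<^sub>R word_deriv2 (x # w)
       + (\<Sum>i<length (x # w). t ^ (i + 3) *\<^sub>R R' i)" for t
  proof -
    have "(\<Sum>i<length (x # w). t ^ (i + 3) *\<^sub>R R' i)
       = X * (\<Sum>i<length w. t ^ (i + 3) *\<^sub>R R i) + t ^ 3 *\<^sub>R (H * word_deriv2 w)
         + (t *\<^sub>R H) * (\<Sum>i<length w. t ^ (i + 3) *\<^sub>R R i)"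
    proof -
      have "(\<Sum>i<length (x # w). t ^ (i + 3) *\<^sub>R R' i)
        = (\<Sum>i<Suc (length w). t ^ (i + 3) *\<^sub>R (if i < length w then X * R i else 0))
        + (\<Sum>i<Suc (length w). t ^ (i + 3) *\<^sub>R (if i = 0 then H * word_deriv2 w else H * R (i - 1)))"
        by (simp only: R'_def scaleR_add_right sum.distrib list.size add_0_right add_Suc_right One_nat_def)
      also have "(\<Sum>i<Suc (length w). t ^ (i + 3) *\<^sub>R (if i < length w then X * R i else 0))
        = X * (\<Sum>i<length w. t ^ (i + 3) *\<^sub>R R i)"
        by (simp add: sum_distrib_left scaleR_mult_ncpoly)
      also have "(\<Sum>i<Suc (length w). t ^ (i + 3) *\<^sub>R (if i = 0 then H * word_deriv2 w else H * R (i - 1)))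
        = t ^ 3 *\<^sub>R (H * word_deriv2 w) + (t *\<^sub>R H) * (\<Sum>i<length w. t ^ (i + 3) *\<^sub>R R i)"
        by (subst sum.lessThan_Suc_shift) (simp add: sum_distrib_left scaleR_mult_ncpoly eval_nat_numeral mult_ac)
      finally show ?thesis by (simp add: add_ac)
    qed
    moreover have "nc_word (map Inl (x # w)) = X * nc_word (map Inl w)"
      "nc_word (Inr x # map Inl w) = H * nc_word (map Inl w)"
      by (simp_all add: X_def H_def nc_word_mult)
    ultimately show ?thesis
      by (simp add: R word_deriv_Cons word_deriv2_Cons flip: X_def H_def)
        (simp add: algebra_simps scaleR_mult_ncpoly power2_eq_square power3_eq_cube)
  qed
  then show ?case by blast
qed

text \<open>Exponents of the form \<open>N i + 3\<close> guarantee that the remainder still vanishes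
  at 0 after two differentiations.\<close>

lemma vector_derivative_expand:
  fixes F :: "real \<Rightarrow> 'b::real_normed_vector"
  assumes F: "\<And>t. F t = A + t *\<^sub>R B + t\<^sup>2 *\<^sub>R C + (\<Sum>i\<in>I. t ^ (N i + 3) *\<^sub>R R i)"
  shows "vector_derivative F (at 0) = B"
    and "vector_derivative (\<lambda>s. vector_derivative F (at s)) (at 0) = 2 *\<^sub>R C"
proof -
  have 1: "(F has_vector_derivative B + (2 * t) *\<^sub>R C
      + (\<Sum>i\<in>I. (real (N i + 3) * t ^ (N i + 2)) *\<^sub>R R i)) (at t)" for t
    unfolding F[abs_def]
    by (auto intro!: derivative_eq_intros simp: algebra_simps)
  then have 2: "vector_derivative F (at t) = B + (2 * t) *\<^sub>R C
      + (\<Sum>i\<in>I. (real (N i + 3) * t ^ (N i + 2)) *\<^sub>R R i)" for t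
    by (rule vector_derivative_at)
  show "vector_derivative F (at 0) = B"
    by (simp add: 2)
  have "((\<lambda>s. vector_derivative F (at s)) has_vector_derivative 2 *\<^sub>R C
      + (\<Sum>i\<in>I. (real (N i + 3) * (real (N i + 2) * 0 ^ (N i + 1))) *\<^sub>R R i)) (at 0)"
    unfolding 2
    by (auto intro!: derivative_eq_intros simp: algebra_simps)
  then show "vector_derivative (\<lambda>s. vector_derivative F (at s)) (at 0) = 2 *\<^sub>R C"
    by (auto dest: vector_derivative_at)
qed

lemma nc_deriv_eq:
  fixes p :: "'g ncpoly"
  shows "nc_deriv p = nc_ext word_deriv p"
  and nc_hessian_eq: "nc_hessian p = 2 *\<^sub>R nc_ext word_deriv2 p"
proof -
  have "\<forall>w :: 'g list. \<exists>R. \<forall>t. prod_list (map (\<lambda>j. nc_word [Inl j] + t *\<^sub>R nc_word [Inr j]) w)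
     = nc_word (map Inl w) + t *\<^sub>R word_deriv w + t\<^sup>2 *\<^sub>R word_deriv2 w
       + (\<Sum>i<length w. t ^ (i + 3) *\<^sub>R R i)"
    by (intro allI prod_shift_expand)
  from choice[OF this] obtain R :: "'g list \<Rightarrow> nat \<Rightarrow> ('g + 'g) ncpoly"
    where R: "\<And>w t. prod_list (map (\<lambda>j. nc_word [Inl j] + t *\<^sub>R nc_word [Inr j]) w)
     = nc_word (map Inl w) + t *\<^sub>R word_deriv w + t\<^sup>2 *\<^sub>R word_deriv2 w
       + (\<Sum>i<length w. t ^ (i + 3) *\<^sub>R R w i)"
    by blast
  \<comment> \<open>The remainders of all words are gathered in one sum over pairs
    \<open>(w, i)\<close>, the shape that \<open>vector_derivative_expand\<close> expects.\<close>
  have "nc_shift p t = nc_ext (\<lambda>w. nc_word (map Inl w)) p + t *\<^sub>R nc_ext word_deriv p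
      + t\<^sup>2 *\<^sub>R nc_ext word_deriv2 p
      + (\<Sum>(w, i)\<in>(SIGMA w:Poly_Mapping.keys p. {..<length w}).
           t ^ (i + 3) *\<^sub>R (Poly_Mapping.lookup p w *\<^sub>R R w i))" for t
  proof -
    have "(\<Sum>(w, i)\<in>(SIGMA w:Poly_Mapping.keys p. {..<length w}).
           t ^ (i + 3) *\<^sub>R (Poly_Mapping.lookup p w *\<^sub>R R w i))
      = (\<Sum>w\<in>Poly_Mapping.keys p. \<Sum>i<length w. t ^ (i + 3) *\<^sub>R (Poly_Mapping.lookup p w *\<^sub>R R w i))"
      by (subst sum.Sigma) auto
    then show ?thesis
      by (simp add: nc_shift_def nc_subst_def R nc_ext_def scaleR_sum_right scaleR_add_right
          sum.distrib mult.commute)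
  qed
  then have F: "nc_shift p t = nc_ext (\<lambda>w. nc_word (map Inl w)) p + t *\<^sub>R nc_ext word_deriv p
      + t\<^sup>2 *\<^sub>R nc_ext word_deriv2 p
      + (\<Sum>z\<in>(SIGMA w:Poly_Mapping.keys p. {..<length w}).
           t ^ (snd z + 3) *\<^sub>R (Poly_Mapping.lookup p (fst z) *\<^sub>R R (fst z) (snd z)))" for t
    by (simp add: case_prod_unfold)
  show "nc_deriv p = nc_ext word_deriv p" "nc_hessian p = 2 *\<^sub>R nc_ext word_deriv2 p"
    unfolding nc_deriv_def nc_hessian_def using vector_derivative_expand[OF F] by auto
qed

section \<open>Evaluation\<close>

lemma nc_ext_cong:
  "(\<And>w. w \<in> Poly_Mapping.keys p \<Longrightarrow> f w = g w) \<Longrightarrow> nc_ext f p = nc_ext g p"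
  by (simp add: nc_ext_def)

lemma nc_ext_sum_fun: "nc_ext (\<lambda>w. \<Sum>i\<in>I. f i w) p = (\<Sum>i\<in>I. nc_ext (f i) p)"
  unfolding nc_ext_def scaleR_sum_right by (rule sum.swap)

lemma nc_ext_add_fun: "nc_ext (\<lambda>w. f w + g w) p = nc_ext f p + nc_ext g p"
  by (simp add: nc_ext_def scaleR_add_right sum.distrib)

lemma nc_ext_diff_fun: "nc_ext (\<lambda>w. f w - g w) p = nc_ext f p - nc_ext g p"
  by (simp add: nc_ext_def scaleR_diff_right sum_subtractf)

lemma nc_ext_mult_fun:
  fixes f :: "'x \<Rightarrow> real"
  shows "nc_ext (\<lambda>w. c * f w) p = c * nc_ext f p" "nc_ext (\<lambda>w. f w * c) p = nc_ext f p * c"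
  by (simp_all add: nc_ext_def sum_distrib_left sum_distrib_right mult_ac)

lemma nc_ext_nc_ext: "nc_ext f (nc_ext g p) = nc_ext (\<lambda>w. nc_ext f (g w)) p"
  unfolding nc_ext_def[of g p] nc_ext_sum nc_ext_scaleR nc_ext_def[of "\<lambda>w. nc_ext f (g w)" p] ..

lemma sym_tuplesD:
  "Y \<in> sym_tuples n \<Longrightarrow> Y j \<in> carrier_mat n n"
  "Y \<in> sym_tuples n \<Longrightarrow> transpose_mat (Y j) = Y j"
  by (auto simp: sym_tuples_def)

lemma case_sum_sym_tuples:
  "X \<in> sym_tuples n \<Longrightarrow> H \<in> sym_tuples n \<Longrightarrow> case_sum X H \<in> sym_tuples n"
  by (auto simp: sym_tuples_def split: sum.split)

lemma eval_word_Nil [simp]: "eval_word n Y [] = 1\<^sub>m n"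
  and eval_word_Cons [simp]: "eval_word n Y (x # w) = Y x * eval_word n Y w"
  by (simp_all add: eval_word_def)

lemma eval_word_map [simp]: "eval_word n Y (map f w) = eval_word n (\<lambda>j. Y (f j)) w"
  by (induction w) simp_all

lemma eval_word_carrier [simp]:
  "Y \<in> sym_tuples n \<Longrightarrow> eval_word n Y w \<in> carrier_mat n n"
  by (induction w) (auto intro: mult_carrier_mat sym_tuplesD)

lemma eval_word_append:
  assumes "Y \<in> sym_tuples n"
  shows "eval_word n Y (u @ w) = eval_word n Y u * eval_word n Y w"
proof (induction u)
  case Nil
  then show ?case
    using left_mult_one_mat[OF eval_word_carrier[OF assms, of w]] by simp
next
  case (Cons x u)
  then show ?case
    by (simp add: assoc_mult_mat[of _ n n _ n _ n] assms sym_tuplesD(1))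
qed

lemma transpose_eval_word:
  assumes "Y \<in> sym_tuples n"
  shows "transpose_mat (eval_word n Y w) = eval_word n Y (rev w)"
proof (induction w)
  case Nil
  then show ?case by simp
next
  case (Cons x w)
  have "Y x * 1\<^sub>m n = Y x"
    using sym_tuplesD(1)[OF assms] by (rule right_mult_one_mat)
  then show ?case
    by (simp add: transpose_mult[of _ n n _ n] assms sym_tuplesD(1)[OF assms] sym_tuplesD(2)[OF assms] Cons eval_word_append)
qed

lemma scalar_prod_eval_word_rev:
  assumes "Y \<in> sym_tuples n" "x \<in> carrier_vec n" "y \<in> carrier_vec n"
  shows "(eval_word n Y (rev w) *\<^sub>v x) \<bullet> y = x \<bullet> (eval_word n Y w *\<^sub>v y)"
  using transpose_vec_mult_scalar[of "eval_word n Y w" n n y x] assms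
  by (simp add: transpose_eval_word)

lemma index_mult_mat_vec_sum:
  "A \<in> carrier_mat n n \<Longrightarrow> v \<in> carrier_vec n \<Longrightarrow> i < n \<Longrightarrow>
    (A *\<^sub>v v) $ i = (\<Sum>k<n. A $$ (i, k) * v $ k)"
  by (auto simp: scalar_prod_def lessThan_atLeast0 intro!: sum.cong)

lemma scalar_prod_lessThan: "y \<in> carrier_vec n \<Longrightarrow> x \<bullet> y = (\<Sum>i<n. x $ i * y $ i)"
  by (simp add: scalar_prod_def lessThan_atLeast0)

lemma eval_word_mult_vec_carrier [simp]:
  "Y \<in> sym_tuples n \<Longrightarrow> v \<in> carrier_vec n \<Longrightarrow> eval_word n Y w *\<^sub>v v \<in> carrier_vec n"
  by (rule mult_mat_vec_carrier[of _ n n]) simp_all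

lemma eval_word_append_mult_vec:
  "Y \<in> sym_tuples n \<Longrightarrow> v \<in> carrier_vec n \<Longrightarrow>
    eval_word n Y (u @ w) *\<^sub>v v = eval_word n Y u *\<^sub>v (eval_word n Y w *\<^sub>v v)"
  by (simp add: eval_word_append assoc_mult_mat_vec[of _ n n _ n])

lemma eval_word_Cons_mult_vec:
  "Y \<in> sym_tuples n \<Longrightarrow> v \<in> carrier_vec n \<Longrightarrow>
    eval_word n Y (x # w) *\<^sub>v v = Y x *\<^sub>v (eval_word n Y w *\<^sub>v v)"
  by (simp add: sym_tuplesD(1) assoc_mult_mat_vec[of _ n n _ n])

lemma index_nc_eval_mult_vec:
  assumes "Y \<in> sym_tuples n" "v \<in> carrier_vec n" "i < n"
  shows "(nc_eval n Y p *\<^sub>v v) $ i = nc_ext (\<lambda>w. (eval_word n Y w *\<^sub>v v) $ i) p"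
proof -
  have "(eval_word n Y w *\<^sub>v v) $ i = (\<Sum>k<n. eval_word n Y w $$ (i, k) * v $ k)" for w
    using assms by (intro index_mult_mat_vec_sum) simp_all
  then have "nc_ext (\<lambda>w. (eval_word n Y w *\<^sub>v v) $ i) p
      = (\<Sum>k<n. nc_ext (\<lambda>w. eval_word n Y w $$ (i, k)) p * v $ k)"
    by (simp add: nc_ext_sum_fun nc_ext_mult_fun)
  then show ?thesis
    using assms by (simp add: scalar_prod_def nc_eval_def nc_ext_def lessThan_atLeast0)
qed

lemma nc_eval_quadratic_form:
  assumes "Y \<in> sym_tuples n" "v \<in> carrier_vec n"
  shows "(nc_eval n Y p *\<^sub>v v) \<bullet> v = nc_ext (\<lambda>w. (eval_word n Y w *\<^sub>v v) \<bullet> v) p"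
  using assms by (simp add: scalar_prod_lessThan index_nc_eval_mult_vec nc_ext_sum_fun nc_ext_mult_fun)

lemma linear_nc_eval_quadratic_form:
  assumes "Y \<in> sym_tuples n" "v \<in> carrier_vec n"
  shows "linear (\<lambda>p. (nc_eval n Y p *\<^sub>v v) \<bullet> v)"
  unfolding nc_eval_quadratic_form[OF assms] by (rule linear_nc_ext)

text \<open>Both sides are bilinear in \<open>a\<close> and \<open>b\<close>, so words suffice;
  there, transposition moves the reversed word to the other side of the scalar product. With
  \<open>a = b = nc_deriv p\<close> this shows that the term with the multiplier vanishes once the
  derivative annihilates \<open>v\<close>.\<close>

lemma nc_eval_adj_mult:
  assumes Y: "Y \<in> sym_tuples n" and v: "v \<in> carrier_vec n"
  shows "(nc_eval n Y (nc_adj a * b) *\<^sub>v v) \<bullet> v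
    = (\<Sum>i<n. (nc_eval n Y a *\<^sub>v v) $ i * (nc_eval n Y b *\<^sub>v v) $ i)"
proof -
  note q = linear_nc_eval_quadratic_form[OF Y v]
  have lin: "linear (\<lambda>b. \<Sum>i<n. c i * (nc_eval n Y b *\<^sub>v v) $ i)"
    "linear (\<lambda>b. \<Sum>i<n. (nc_eval n Y b *\<^sub>v v) $ i * c i)" for c
    by (rule linearI; simp add: index_nc_eval_mult_vec Y v nc_ext_add nc_ext_scaleR
        sum.distrib sum_distrib_left algebra_simps)+
  show ?thesis
  proof (rule linear_eq_on_words[of "\<lambda>a. (nc_eval n Y (nc_adj a * b) *\<^sub>v v) \<bullet> v", OF _ lin(2)])
    show "linear (\<lambda>a. (nc_eval n Y (nc_adj a * b) *\<^sub>v v) \<bullet> v)"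
      using linear_compose[OF linear_compose[OF linear_nc_adj linear_mult_ncpoly(2)[of b]] q]
      by (simp add: o_def)
    fix u
    show "(nc_eval n Y (nc_adj (nc_word u) * b) *\<^sub>v v) \<bullet> v
      = (\<Sum>i<n. (nc_eval n Y (nc_word u) *\<^sub>v v) $ i * (nc_eval n Y b *\<^sub>v v) $ i)"
    proof (rule linear_eq_on_words[of "\<lambda>b. (nc_eval n Y (nc_adj (nc_word u) * b) *\<^sub>v v) \<bullet> v", OF _ lin(1)])
      show "linear (\<lambda>b. (nc_eval n Y (nc_adj (nc_word u) * b) *\<^sub>v v) \<bullet> v)"
        using linear_compose[OF linear_mult_ncpoly(1)[of "nc_adj (nc_word u)"] q]
        by (simp add: o_def)
      fix w
      have "(nc_eval n Y (nc_adj (nc_word u) * nc_word w) *\<^sub>v v) \<bullet> v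
        = (eval_word n Y (rev u) *\<^sub>v (eval_word n Y w *\<^sub>v v)) \<bullet> v"
        using Y v by (simp add: nc_word_mult nc_eval_quadratic_form eval_word_append
            assoc_mult_mat_vec[of _ n n _ n])
      also have "\<dots> = (eval_word n Y w *\<^sub>v v) \<bullet> (eval_word n Y u *\<^sub>v v)"
        using Y v by (intro scalar_prod_eval_word_rev mult_mat_vec_carrier[of _ n n]) auto
      also have "\<dots> = (\<Sum>i<n. (nc_eval n Y (nc_word u) *\<^sub>v v) $ i * (nc_eval n Y (nc_word w) *\<^sub>v v) $ i)"
        using scalar_prod_lessThan[OF eval_word_mult_vec_carrier[OF Y v], of _ u] Y v
        by (simp add: index_nc_eval_mult_vec mult.commute del: index_mult_mat_vec)
      finally show "(nc_eval n Y (nc_adj (nc_word u) * nc_word w) *\<^sub>v v) \<bullet> v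
        = (\<Sum>i<n. (nc_eval n Y (nc_word u) *\<^sub>v v) $ i * (nc_eval n Y (nc_word w) *\<^sub>v v) $ i)" .
    qed
  qed
qed

lemma transpose_mat_smult: "transpose_mat (c \<cdot>\<^sub>m A) = c \<cdot>\<^sub>m transpose_mat A"
  by (rule eq_matI) auto

section \<open>Coordinates for the space containing the vectors V-tilde(X)[H]v\<close>

lemma finite_Vt_index: "finite (Vt_index d :: ('g::finite \<times> 'g list) set)"
proof -
  have "finite {m :: 'g list. length m < d}"
    by (rule finite_subset[OF _ finite_lists_length_le[of UNIV d]]) auto
  then show ?thesis
    by (simp add: Vt_index_def)
qed

text \<open>Vectors with freely prescribed entries, in the same coordinates as
  \<open>Vt_vec\<close>, so that candidates for membership in the space of all \<open>Vt_vec\<close>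
  can be written down.\<close>

definition block_vec :: "nat \<Rightarrow> nat \<Rightarrow> ('g::finite \<Rightarrow> 'g list \<Rightarrow> nat \<Rightarrow> real) \<Rightarrow> ('g \<times> 'g list \<times> nat) \<Rightarrow>\<^sub>0 real" where
  "block_vec n d y = (\<Sum>(j, m)\<in>Vt_index d. \<Sum>i<n. Poly_Mapping.single (j, m, i) (y j m i))"

lemma lookup_block_vec:
  "Poly_Mapping.lookup (block_vec n d y) (j, m, i) = (if length m < d \<and> i < n then y j m i else 0)"
proof -
  have "Poly_Mapping.lookup (block_vec n d y) (j, m, i)
     = (\<Sum>z\<in>Vt_index d. \<Sum>k<n. if z = (j, m) then if k = i then y j m i else 0 else 0)"
    by (auto simp: block_vec_def lookup_sum lookup_single when_def intro!: sum.cong)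
  also have "\<dots> = (\<Sum>z\<in>Vt_index d. if z = (j, m) then \<Sum>k<n. if k = i then y j m i else 0 else 0)"
    by (intro sum.cong) auto
  also have "\<dots> = (if length m < d \<and> i < n then y j m i else 0)"
    by (simp add: finite_Vt_index) (simp add: Vt_index_def)
  finally show ?thesis .
qed

lemma block_vec_cong:
  "(\<And>j m i. length m < d \<Longrightarrow> i < n \<Longrightarrow> y j m i = z j m i) \<Longrightarrow> block_vec n d y = block_vec n d z"
  by (rule poly_mapping_eqI) (auto simp: lookup_block_vec)

text \<open>The unit vectors number at most \<open>n * card (Vt_index d)\<close>, which bounds the
  ambient dimension in the later count.\<close>

lemma block_vec_in_span:
  "block_vec n d y \<in> span ((\<lambda>((j, m), i). Poly_Mapping.single (j, m, i) 1) ` (Vt_index d \<times> {..<n}))"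
  unfolding block_vec_def
proof (rule span_sum)
  fix z :: "'a \<times> 'a list" assume z: "z \<in> Vt_index d"
  obtain j m where jm: "z = (j, m)" by fastforce
  have "Poly_Mapping.single (j, m, i) (y j m i)
      \<in> span ((\<lambda>((j, m), i). Poly_Mapping.single (j, m, i) 1) ` (Vt_index d \<times> {..<n}))" if "i < n" for i
  proof -
    have eq: "Poly_Mapping.single (j, m, i) (y j m i) = y j m i *\<^sub>R Poly_Mapping.single (j, m, i) 1"
      by (rule poly_mapping_eqI) (simp add: lookup_single when_def)
    show ?thesis
      unfolding eq using z jm that
      by (intro span_scale span_base) (auto intro!: image_eqI[of _ _ "((j, m), i)"])
  qed
  then show "(case z of (j, m) \<Rightarrow> \<Sum>i<n. Poly_Mapping.single (j, m, i) (y j m i))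
      \<in> span ((\<lambda>((j, m), i). Poly_Mapping.single (j, m, i) 1) ` (Vt_index d \<times> {..<n}))"
    unfolding jm by (auto intro!: span_sum)
qed

lemma card_Vt_index: "card (Vt_index d :: ('g::finite \<times> 'g list) set) = CARD('g) * (\<Sum>i<d. CARD('g) ^ i)"
proof -
  have "{m :: 'g list. length m < d} = (\<Union>i<d. {m. set m \<subseteq> UNIV \<and> length m = i})"
    by auto
  then have "card {m :: 'g list. length m < d} = (\<Sum>i<d. card {m :: 'g list. set m \<subseteq> UNIV \<and> length m = i})"
    by (simp only:) (subst card_UN_disjoint; use finite_lists_length_eq[of "UNIV :: 'g set"] in auto)
  also have "\<dots> = (\<Sum>i<d. CARD('g) ^ i)"
    using card_lists_length_eq[of "UNIV :: 'g set"] by simp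
  finally show ?thesis
    by (simp add: Vt_index_def card_cartesian_product)
qed

lemma Vt_vec_eq_block_vec:
  assumes "X \<in> sym_tuples n" "H \<in> sym_tuples n" "v \<in> carrier_vec n"
  shows "Vt_vec n d X H v = block_vec n d (\<lambda>j m i. (H j *\<^sub>v (eval_word n X m *\<^sub>v v)) $ i)"
proof -
  have "(nc_eval n (case_sum X H) (Vt_entry j m) *\<^sub>v v) $ i = (H j *\<^sub>v (eval_word n X m *\<^sub>v v)) $ i"
    if "i < n" for j m i
    using assms that case_sum_sym_tuples[OF assms(1,2)]
    by (simp add: Vt_entry_def index_nc_eval_mult_vec sym_tuplesD assoc_mult_mat_vec[of _ n n _ n]
         del: index_mult_mat_vec)
  then show ?thesis
    by (simp add: Vt_vec_def block_vec_def case_prod_unfold)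
qed

text \<open>For fixed \<open>X\<close> and \<open>v\<close> all coordinates are linear in
  \<open>H\<close>, and symmetric tuples are closed under linear combinations.\<close>

lemma subspace_Vt_vec:
  assumes X: "X \<in> sym_tuples n" and v: "v \<in> carrier_vec n"
  shows "subspace {Vt_vec n d X H v | H. H \<in> sym_tuples n}"
proof -
  define u where "u m = eval_word n X m *\<^sub>v v" for m
  have u: "u m \<in> carrier_vec n" for m
    unfolding u_def using X v by simp
  have Vt: "Vt_vec n d X H v = block_vec n d (\<lambda>j m i. \<Sum>k<n. H j $$ (i, k) * u m $ k)"
    if "H \<in> sym_tuples n" for H
    unfolding Vt_vec_eq_block_vec[OF X that v] u_def[symmetric]
    by (intro block_vec_cong index_mult_mat_vec_sum u sym_tuplesD(1)[OF that])
  show ?thesis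
  proof (rule subspaceI)
    have "(\<lambda>_. 0\<^sub>m n n) \<in> sym_tuples n"
      by (simp add: sym_tuples_def)
    moreover from Vt[OF this] have "Vt_vec n d X (\<lambda>_. 0\<^sub>m n n) v = 0"
      by (intro poly_mapping_eqI) (auto simp: lookup_block_vec split_paired_all)
    ultimately show "0 \<in> {Vt_vec n d X H v | H. H \<in> sym_tuples n}"
      by force
  next
    fix x y assume "x \<in> {Vt_vec n d X H v | H. H \<in> sym_tuples n}" "y \<in> {Vt_vec n d X H v | H. H \<in> sym_tuples n}"
    then obtain H K where HK: "H \<in> sym_tuples n" "K \<in> sym_tuples n"
      "x = Vt_vec n d X H v" "y = Vt_vec n d X K v" by blast
    have c: "H j \<in> carrier_mat n n" "K j \<in> carrier_mat n n" for j
      using HK by (auto dest: sym_tuplesD)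
    have HK': "(\<lambda>j. H j + K j) \<in> sym_tuples n"
      using HK c by (auto simp: sym_tuples_def transpose_add[of _ n n])
    have "x + y = Vt_vec n d X (\<lambda>j. H j + K j) v"
      unfolding HK(3,4) Vt[OF HK(1)] Vt[OF HK(2)] Vt[OF HK'] using c carrier_matD[OF c(1)] carrier_matD[OF c(2)]
      by (intro poly_mapping_eqI) (auto simp: lookup_block_vec lookup_add split_paired_all
          algebra_simps sum.distrib)
    then show "x + y \<in> {Vt_vec n d X H v | H. H \<in> sym_tuples n}"
      using HK' by blast
  next
    fix c x assume "x \<in> {Vt_vec n d X H v | H. H \<in> sym_tuples n}"
    then obtain H where H: "H \<in> sym_tuples n" "x = Vt_vec n d X H v" by blast
    have c: "H j \<in> carrier_mat n n" for j
      using H by (auto dest: sym_tuplesD)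
    have H': "(\<lambda>j. c \<cdot>\<^sub>m H j) \<in> sym_tuples n"
      using H c by (auto simp: sym_tuples_def transpose_mat_smult)
    have "c *\<^sub>R x = Vt_vec n d X (\<lambda>j. c \<cdot>\<^sub>m H j) v"
      unfolding H(2) Vt[OF H(1)] Vt[OF H'] using c carrier_matD[OF c]
      by (intro poly_mapping_eqI) (auto simp: lookup_block_vec split_paired_all
          sum_distrib_left mult_ac)
    then show "c *\<^sub>R x \<in> {Vt_vec n d X H v | H. H \<in> sym_tuples n}"
      using H' by blast
  qed
qed

section \<open>Evaluating the relaxed Hessian\<close>

text \<open>Half of \<open>\<langle>p''(X)[H]v, v\<rangle>\<close>, polarised, when \<open>H\<^sub>j m(X) v = \<alpha> j m \<cdot> b\<close>.\<close>

definition hess_form ::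
    "nat \<Rightarrow> ('g \<Rightarrow> real Matrix.mat) \<Rightarrow> 'g ncpoly \<Rightarrow> ('g \<Rightarrow> 'g list \<Rightarrow> real) \<Rightarrow> ('g \<Rightarrow> 'g list \<Rightarrow> real)
      \<Rightarrow> real Matrix.vec \<Rightarrow> real" where
  "hess_form n X p \<alpha> \<beta> b = nc_ext (\<lambda>w. \<Sum>(a, j, u, k, m)\<in>splits2 w.
     \<alpha> j (rev a) * \<beta> k m * (b \<bullet> (eval_word n X u *\<^sub>v b))) p"

text \<open>The length bound leaves no room for a prefix in front of \<open>j1 # m1\<close>. Hence a
  block of top length enters the first derivative without any matrix factor.\<close>

lemma sum_splits1_last:
  assumes "length w \<le> Suc (length m1)"
  shows "(\<Sum>(a, j, m)\<in>splits1 w. if j = j1 \<and> m = m1 then f a else (0::real))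
    = (if w = j1 # m1 then f [] else 0)"
proof -
  have "(\<Sum>(a, j, m)\<in>splits1 w. if j = j1 \<and> m = m1 then f a else 0)
    = (\<Sum>z\<in>splits1 w \<inter> {([], j1, m1)}. f [])"
    using assms
    by (intro sum.mono_neutral_cong_right[OF finite_splits1]) (auto simp: splits1_def split: if_splits)
  also have "\<dots> = (if w = j1 # m1 then f [] else 0)"
    by (auto simp: splits1_def)
  finally show ?thesis .
qed

lemma nc_ext_single_word:
  "nc_ext (\<lambda>w. if w = w0 then c else 0) p = Poly_Mapping.lookup p w0 *\<^sub>R c"
  by (cases "w0 \<in> Poly_Mapping.keys p")
    (auto simp: nc_ext_def if_distrib in_keys_iff cong: if_cong)

text \<open>By \<open>sum_splits1_last\<close>, the extra block \<open>z\<close> contributes just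
  the coefficient of \<open>j1 # m1\<close> times \<open>z i\<close>; the equation for
  \<open>z\<close> says that this cancels the part linear in \<open>b\<close>.\<close>

lemma nc_eval_deriv_eq_0:
  assumes X: "X \<in> sym_tuples n" and H: "H \<in> sym_tuples n" and v: "v \<in> carrier_vec n"
    and deg: "nc_degree p \<le> Suc (length m1)" and i: "i < n"
    and c: "Poly_Mapping.lookup p (j1 # m1) \<noteq> 0"
    and HV: "\<And>j m k. length m \<le> length m1 \<Longrightarrow> k < n \<Longrightarrow>
      (H j *\<^sub>v (eval_word n X m *\<^sub>v v)) $ k = \<alpha> j m * b k + (if j = j1 \<and> m = m1 then z k else 0)"
    and z: "Poly_Mapping.lookup p (j1 # m1) * z i
      = - (\<Sum>k<n. nc_ext (\<lambda>w. \<Sum>(a, j, m)\<in>splits1 w. \<alpha> j m * eval_word n X a $$ (i, k)) p * b k)"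
  shows "(nc_eval n (case_sum X H) (nc_deriv p) *\<^sub>v v) $ i = 0"
proof -
  define u where "u j m = H j *\<^sub>v (eval_word n X m *\<^sub>v v)" for j m
  have u: "u j m \<in> carrier_vec n" for j m
    unfolding u_def using X H v by (intro mult_mat_vec_carrier[of _ n n]) (auto dest: sym_tuplesD)
  note XH = case_sum_sym_tuples[OF X H]
  have word: "(eval_word n (case_sum X H) (map Inl a @ Inr j # map Inl m) *\<^sub>v v) $ i
      = (\<Sum>k<n. eval_word n X a $$ (i, k) * u j m $ k)" for a j m
  proof -
    have "eval_word n (case_sum X H) (map Inl a @ Inr j # map Inl m) *\<^sub>v v = eval_word n X a *\<^sub>v u j m"
      unfolding u_def using X H v XH
      by (simp add: eval_word_append_mult_vec eval_word_Cons_mult_vec del: eval_word_Cons)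
    then show ?thesis
      using index_mult_mat_vec_sum[OF eval_word_carrier[OF X] u i] by simp
  qed
  have split: "(\<Sum>(a, j, m)\<in>splits1 w. \<Sum>k<n. eval_word n X a $$ (i, k) * u j m $ k)
      = (\<Sum>k<n. (\<Sum>(a, j, m)\<in>splits1 w. \<alpha> j m * eval_word n X a $$ (i, k)) * b k)
        + (if w = j1 # m1 then z i else 0)" if w: "w \<in> Poly_Mapping.keys p" for w
  proof -
    have len: "length w \<le> Suc (length m1)"
      using deg w by (auto simp: nc_degree_le_iff)
    have summand: "(\<Sum>k<n. eval_word n X a $$ (i, k) * u j m $ k)
      = (\<Sum>k<n. \<alpha> j m * eval_word n X a $$ (i, k) * b k)
        + (if j = j1 \<and> m = m1 then \<Sum>k<n. eval_word n X a $$ (i, k) * z k else 0)"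
      if "(a, j, m) \<in> splits1 w" for a j m
    proof -
      have "length m \<le> length m1"
        using that len by (auto simp: splits1_def)
      then have "(\<Sum>k<n. eval_word n X a $$ (i, k) * u j m $ k)
        = (\<Sum>k<n. eval_word n X a $$ (i, k) * (\<alpha> j m * b k + (if j = j1 \<and> m = m1 then z k else 0)))"
        unfolding u_def by (intro sum.cong) (simp_all add: HV del: index_mult_mat_vec)
      also have "\<dots> = (\<Sum>k<n. \<alpha> j m * eval_word n X a $$ (i, k) * b k)
        + (if j = j1 \<and> m = m1 then \<Sum>k<n. eval_word n X a $$ (i, k) * z k else 0)"
        by (auto simp: algebra_simps sum.distrib)
      finally show ?thesis .
    qed
    have "(\<Sum>(a, j, m)\<in>splits1 w. \<Sum>k<n. eval_word n X a $$ (i, k) * u j m $ k)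
      = (\<Sum>(a, j, m)\<in>splits1 w. (\<Sum>k<n. \<alpha> j m * eval_word n X a $$ (i, k) * b k)
        + (if j = j1 \<and> m = m1 then \<Sum>k<n. eval_word n X a $$ (i, k) * z k else 0))"
      using summand by (intro sum.cong refl) auto
    also have "\<dots> = (\<Sum>(a, j, m)\<in>splits1 w. \<Sum>k<n. \<alpha> j m * eval_word n X a $$ (i, k) * b k)
      + (\<Sum>(a, j, m)\<in>splits1 w. if j = j1 \<and> m = m1 then \<Sum>k<n. eval_word n X a $$ (i, k) * z k else 0)"
      by (simp add: case_prod_unfold sum.distrib)
    also have "(\<Sum>(a, j, m)\<in>splits1 w. if j = j1 \<and> m = m1 then \<Sum>k<n. eval_word n X a $$ (i, k) * z k else 0)
      = (if w = j1 # m1 then \<Sum>k<n. eval_word n X [] $$ (i, k) * z k else 0)"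
      by (rule sum_splits1_last[OF len])
    also have "(\<Sum>k<n. eval_word n X [] $$ (i, k) * z k) = (\<Sum>k<n. if k = i then z i else 0)"
      using i by (intro sum.cong) auto
    also have "\<dots> = z i"
      using i by simp
    also have "(\<Sum>(a, j, m)\<in>splits1 w. \<Sum>k<n. \<alpha> j m * eval_word n X a $$ (i, k) * b k)
      = (\<Sum>k<n. (\<Sum>(a, j, m)\<in>splits1 w. \<alpha> j m * eval_word n X a $$ (i, k)) * b k)"
      unfolding case_prod_unfold sum_distrib_right by (rule sum.swap)
    finally show ?thesis .
  qed
  have "(nc_eval n (case_sum X H) (nc_deriv p) *\<^sub>v v) $ i
    = nc_ext (\<lambda>w. \<Sum>(a, j, m)\<in>splits1 w. \<Sum>k<n. eval_word n X a $$ (i, k) * u j m $ k) p"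
    using XH v i
    by (simp add: index_nc_eval_mult_vec nc_deriv_eq nc_ext_nc_ext word_deriv_def nc_ext_sum
        case_prod_unfold word del: index_mult_mat_vec eval_word_Cons)
  also have "\<dots> = nc_ext (\<lambda>w. (\<Sum>k<n. (\<Sum>(a, j, m)\<in>splits1 w. \<alpha> j m * eval_word n X a $$ (i, k)) * b k)
        + (if w = j1 # m1 then z i else 0)) p"
    by (rule nc_ext_cong) (rule split)
  also have "\<dots> = (\<Sum>k<n. nc_ext (\<lambda>w. \<Sum>(a, j, m)\<in>splits1 w. \<alpha> j m * eval_word n X a $$ (i, k)) p * b k)
      + Poly_Mapping.lookup p (j1 # m1) * z i"
    by (simp add: nc_ext_add_fun nc_ext_sum_fun[of _ "{..<n}"] nc_ext_mult_fun nc_ext_single_word)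
  finally show ?thesis
    using z by simp
qed

text \<open>Two marked letters in a word of length at most the degree \<open>d\<close> leave at most
  \<open>d - 2\<close> letters on the outside. So only blocks with \<open>length m + 2\<close> at
  most \<open>d\<close> matter, and a correction at length \<open>d - 1\<close> does not change the
  value.\<close>

lemma nc_eval_hessian_quadratic_form:
  assumes X: "X \<in> sym_tuples n" and H: "H \<in> sym_tuples n" and v: "v \<in> carrier_vec n"
    and b: "b \<in> carrier_vec n"
    and HV: "\<And>j m. length m + 2 \<le> nc_degree p \<Longrightarrow> H j *\<^sub>v (eval_word n X m *\<^sub>v v) = \<alpha> j m \<cdot>\<^sub>v b"
  shows "(nc_eval n (case_sum X H) (nc_hessian p) *\<^sub>v v) \<bullet> v = 2 * hess_form n X p \<alpha> \<alpha> b"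
proof -
  note XH = case_sum_sym_tuples[OF X H]
  have word: "(eval_word n (case_sum X H) (map Inl a @ Inr j # map Inl u @ Inr k # map Inl m) *\<^sub>v v) \<bullet> v
      = \<alpha> j (rev a) * \<alpha> k m * (b \<bullet> (eval_word n X u *\<^sub>v b))"
    if "w \<in> Poly_Mapping.keys p" "(a, j, u, k, m) \<in> splits2 w" for w a j u k m
  proof -
    have len: "length w \<le> nc_degree p"
      using that(1) nc_degree_le_iff by blast
    define W where "W = eval_word n X u *\<^sub>v (H k *\<^sub>v (eval_word n X m *\<^sub>v v))"
    have Hc: "H j *\<^sub>v x \<in> carrier_vec n" if "x \<in> carrier_vec n" for j x
      using that H by (intro mult_mat_vec_carrier[of _ n n]) (auto dest: sym_tuplesD)
    have W: "W \<in> carrier_vec n"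
      unfolding W_def using X v Hc by simp
    have W_eq: "W = \<alpha> k m \<cdot>\<^sub>v (eval_word n X u *\<^sub>v b)"
      unfolding W_def using HV[of m k] that(2) len X b
      by (simp add: splits2_def mult_mat_vec[of _ n n])
    \<comment> \<open>The left part of the word and \<open>H j\<close> are moved to the right
      argument by symmetry; this reverses \<open>a\<close>, whence \<open>rev a\<close> in
      \<open>hess_form\<close>.\<close>
    have "(eval_word n (case_sum X H) (map Inl a @ Inr j # map Inl u @ Inr k # map Inl m) *\<^sub>v v) \<bullet> v
      = (eval_word n X (rev (rev a)) *\<^sub>v (H j *\<^sub>v W)) \<bullet> v"
      unfolding W_def using X H v XH Hc
      by (simp add: eval_word_append_mult_vec eval_word_Cons_mult_vec del: eval_word_Cons)
    also have "\<dots> = (H j *\<^sub>v W) \<bullet> (eval_word n X (rev a) *\<^sub>v v)"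
      by (rule scalar_prod_eval_word_rev[OF X Hc[OF W] v])
    also have "\<dots> = W \<bullet> (H j *\<^sub>v (eval_word n X (rev a) *\<^sub>v v))"
      using scalar_prod_eval_word_rev[OF H W, of "eval_word n X (rev a) *\<^sub>v v" "[j]"] X v
        right_mult_one_mat[OF sym_tuplesD(1)[OF H, of j]] by simp
    also have "H j *\<^sub>v (eval_word n X (rev a) *\<^sub>v v) = \<alpha> j (rev a) \<cdot>\<^sub>v b"
      using that(2) len by (intro HV) (auto simp: splits2_def)
    also have "W \<bullet> (\<alpha> j (rev a) \<cdot>\<^sub>v b) = \<alpha> j (rev a) * \<alpha> k m * (b \<bullet> (eval_word n X u *\<^sub>v b))"
      unfolding W_eq using b eval_word_mult_vec_carrier[OF X b, of u]
      by (simp add: comm_scalar_prod[of b n] scalar_prod_smult_left scalar_prod_smult_right carrier_vecD)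
    finally show ?thesis .
  qed
  have "(nc_eval n (case_sum X H) (nc_hessian p) *\<^sub>v v) \<bullet> v
    = 2 * nc_ext (\<lambda>w. \<Sum>(a, j, u, k, m)\<in>splits2 w.
        (eval_word n (case_sum X H) (map Inl a @ Inr j # map Inl u @ Inr k # map Inl m) *\<^sub>v v) \<bullet> v) p"
    unfolding nc_hessian_eq nc_eval_quadratic_form[OF XH v] nc_ext_scaleR nc_ext_nc_ext
    by (simp add: word_deriv2_def nc_ext_sum case_prod_unfold del: eval_word_Cons)
  also have "\<dots> = 2 * hess_form n X p \<alpha> \<alpha> b"
    unfolding hess_form_def using word
    by (intro arg_cong[of _ _ "(*) 2"] nc_ext_cong sum.cong refl) (auto simp del: eval_word_Cons eval_word_map)
  finally show ?thesis .
qed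

text \<open>The codimension and the positivity of the relaxed Hessian are exploited here: the first
  supplies an \<open>H\<close> for which p'(X)[H]v = 0, the second is applied to this
  \<open>H\<close>.\<close>

lemma hess_form_nonneg_somewhere:
  fixes p :: "'g::finite ncpoly"
  assumes X: "X \<in> sym_tuples n" and v: "v \<in> carrier_vec n"
    and codim: "n * (CARD('g) * (\<Sum>i<nc_degree p. CARD('g) ^ i))
      < dim {Vt_vec n (nc_degree p) X H v | H. H \<in> sym_tuples n} + n"
    and pos: "relaxed_hessian_positive n p X v"
    and deg: "nc_degree p > 0"
    and \<alpha>: "\<And>j m. length m + 2 > nc_degree p \<Longrightarrow> \<alpha> j m = 0"
  shows "\<exists>b\<in>carrier_vec n. b \<noteq> 0\<^sub>v n \<and> hess_form n X p \<alpha> \<alpha> b \<ge> 0"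
proof -
  define d where "d = nc_degree p"
  obtain w1 where w1: "w1 \<in> Poly_Mapping.keys p" "length w1 = d"
    using ex_word_of_degree[OF deg] unfolding d_def by blast
  then obtain j1 m1 where jm1: "w1 = j1 # m1" and d: "d = Suc (length m1)"
    using deg unfolding d_def by (cases w1) auto
  define c where "c = Poly_Mapping.lookup p (j1 # m1)"
  have c: "c \<noteq> 0"
    using w1 by (simp add: c_def jm1 in_keys_iff)
  \<comment> \<open>Solves p'(X)[H]v = 0 for the block at \<open>(j1, m1)\<close>: that block must
    be \<open>A\<close> applied to \<open>b\<close>.\<close>
  define A where "A i k = - nc_ext (\<lambda>w. \<Sum>(a, j, m)\<in>splits1 w. \<alpha> j m * eval_word n X a $$ (i, k)) p / c" for i k
  \<comment> \<open>The wanted vector when \<open>b\<close> is the \<open>k\<close>-th unit vector;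
    the general one is the combination with coefficients \<open>b k\<close>.\<close>
  define f where "f k = block_vec n d (\<lambda>j m i. \<alpha> j m * (if i = k then 1 else 0)
      + (if j = j1 \<and> m = m1 then A i k else 0))" for k
  define S where "S = {Vt_vec n d X H v | H. H \<in> sym_tuples n}"
  define T :: "('g \<times> 'g list \<times> nat \<Rightarrow>\<^sub>0 real) set"
    where "T = (\<lambda>((j, m), i). Poly_Mapping.single (j, m, i) 1) ` (Vt_index d \<times> {..<n})"
  have "card T \<le> card ((Vt_index d :: ('g \<times> 'g list) set) \<times> {..<n})"
    unfolding T_def by (intro card_image_le) (simp add: finite_Vt_index)
  also have "\<dots> < dim S + n"
    using codim by (simp add: card_cartesian_product card_Vt_index S_def d_def mult_ac)
  finally have "card T < dim S + n" .
  moreover have "S \<subseteq> span T"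
    unfolding S_def T_def using X v by (auto simp: Vt_vec_eq_block_vec block_vec_in_span)
  moreover have "f k \<in> span T" for k
    unfolding f_def T_def by (rule block_vec_in_span)
  moreover have "finite T"
    by (simp add: T_def finite_Vt_index)
  moreover have "subspace S"
    unfolding S_def by (rule subspace_Vt_vec[OF X v])
  ultimately obtain b where b: "\<exists>k<n. b k \<noteq> 0" "(\<Sum>k<n. b k *\<^sub>R f k) \<in> S"
    using subspace_contains_combination[of S T n f] by blast
  then obtain H where H: "H \<in> sym_tuples n" and eq: "(\<Sum>k<n. b k *\<^sub>R f k) = Vt_vec n d X H v"
    by (auto simp: S_def)
  define z where "z i = (\<Sum>k<n. A i k * b k)" for i
  define bv where "bv = Matrix.vec n b"
  have HV: "(H j *\<^sub>v (eval_word n X m *\<^sub>v v)) $ i = \<alpha> j m * b i + (if j = j1 \<and> m = m1 then z i else 0)"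
    if "length m < d" "i < n" for j m i
  proof -
    have "(H j *\<^sub>v (eval_word n X m *\<^sub>v v)) $ i = Poly_Mapping.lookup (\<Sum>k<n. b k *\<^sub>R f k) (j, m, i)"
      unfolding eq Vt_vec_eq_block_vec[OF X H v] lookup_block_vec using that by simp
    also have "\<dots> = (\<Sum>k<n. b k * (\<alpha> j m * (if i = k then 1 else 0))) + (if j = j1 \<and> m = m1 then z i else 0)"
      using that by (auto simp: lookup_sum f_def lookup_block_vec z_def distrib_left sum.distrib mult.commute)
    also have "(\<Sum>k<n. b k * (\<alpha> j m * (if i = k then 1 else 0))) = \<alpha> j m * b i"
      using that by (simp add: if_distrib cong: if_cong)
    finally show ?thesis .
  qed
  have deriv: "(nc_eval n (case_sum X H) (nc_deriv p) *\<^sub>v v) $ i = 0" if "i < n" for i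
  proof (rule nc_eval_deriv_eq_0[OF X H v _ that])
    show "nc_degree p \<le> Suc (length m1)" "Poly_Mapping.lookup p (j1 # m1) \<noteq> 0"
      using d c by (simp_all add: d_def c_def)
    show "(H j *\<^sub>v (eval_word n X m *\<^sub>v v)) $ k = \<alpha> j m * b k + (if j = j1 \<and> m = m1 then z k else 0)"
      if "length m \<le> length m1" "k < n" for j m k
      using HV that d by simp
    show "Poly_Mapping.lookup p (j1 # m1) * z i
      = - (\<Sum>k<n. nc_ext (\<lambda>w. \<Sum>(a, j, m)\<in>splits1 w. \<alpha> j m * eval_word n X a $$ (i, k)) p * b k)"
      using c by (simp add: z_def A_def sum_distrib_left sum_negf flip: c_def)
  qed
  have hess: "(nc_eval n (case_sum X H) (nc_hessian p) *\<^sub>v v) \<bullet> v = 2 * hess_form n X p \<alpha> \<alpha> bv"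
  proof (rule nc_eval_hessian_quadratic_form[OF X H v])
    fix j :: 'g and m :: "'g list" assume m: "length m + 2 \<le> nc_degree p"
    show "H j *\<^sub>v (eval_word n X m *\<^sub>v v) = \<alpha> j m \<cdot>\<^sub>v bv"
    proof (rule eq_vecI)
      fix i assume "i < dim_vec (\<alpha> j m \<cdot>\<^sub>v bv)"
      then show "(H j *\<^sub>v (eval_word n X m *\<^sub>v v)) $ i = (\<alpha> j m \<cdot>\<^sub>v bv) $ i"
        using HV[of m i j] m d by (auto simp: bv_def d_def)
    qed (use sym_tuplesD(1)[OF H, of j] in \<open>simp add: bv_def\<close>)
  qed (simp add: bv_def)
  \<comment> \<open>The value of the \<delta>-term without its factor. As \<open>H\<close> was fixed
    before \<delta>, it is a constant, and the multiplier \<open>r\<close> may depend on \<delta>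
    because its term is zero.\<close>
  define \<kappa> where "\<kappa> = (nc_eval n (case_sum X H)
    (\<Sum>(j, m)\<in>Vt_index (nc_degree p). nc_adj (Vt_entry j m) * Vt_entry j m) *\<^sub>v v) \<bullet> v"
  have nonneg: "2 * hess_form n X p \<alpha> \<alpha> bv + \<delta> * \<kappa> \<ge> 0" if \<delta>: "\<delta> > 0" for \<delta>
  proof -
    note XH = case_sum_sym_tuples[OF X H]
    note lin = linear_nc_eval_quadratic_form[OF XH v]
    obtain r where "(nc_eval n (case_sum X H) (relaxed_hessian p r \<delta>) *\<^sub>v v) \<bullet> v \<ge> 0"
      using pos H \<delta> unfolding relaxed_hessian_positive_def by blast
    then show ?thesis
      unfolding relaxed_hessian_def linear_add[OF lin] linear_scale[OF lin]
        nc_eval_adj_mult[OF XH v] hess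
      by (simp add: \<kappa>_def deriv del: index_mult_mat_vec)
  qed
  have "hess_form n X p \<alpha> \<alpha> bv \<ge> 0"
  proof (rule ccontr)
    assume "\<not> ?thesis"
    then have neg: "hess_form n X p \<alpha> \<alpha> bv < 0" by simp
    \<comment> \<open>Small enough that the \<delta>-term cancels at most half of the negative value
      \<open>2 * hess_form n X p \<alpha> \<alpha> bv\<close>; adding 1 keeps the denominator
      positive.\<close>
    define \<delta> where "\<delta> = - hess_form n X p \<alpha> \<alpha> bv / (\<bar>\<kappa>\<bar> + 1)"
    have "\<delta> > 0"
      unfolding \<delta>_def by (rule divide_pos_pos) (use neg in auto)
    have "\<delta> * \<kappa> \<le> \<delta> * (\<bar>\<kappa>\<bar> + 1)"
      using \<open>\<delta> > 0\<close> by (intro mult_left_mono) auto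
    also have "\<dots> = - hess_form n X p \<alpha> \<alpha> bv"
      by (simp add: \<delta>_def)
    finally show False
      using nonneg[OF \<open>\<delta> > 0\<close>] neg by linarith
  qed
  moreover have "bv \<noteq> 0\<^sub>v n"
    using b(1) by (auto simp: bv_def vec_eq_iff)
  ultimately show ?thesis
    by (intro bexI[of _ bv]) (auto simp: bv_def)
qed

section \<open>A negative direction in degree at least three\<close>

lemma scalar_prod_self_pos:
  fixes b :: "real Matrix.vec"
  assumes "b \<in> carrier_vec n" "b \<noteq> 0\<^sub>v n"
  shows "b \<bullet> b > 0"
proof -
  obtain i where "i < n" "b $ i \<noteq> 0"
    using assms by (auto simp: vec_eq_iff)
  then have "0 < b $ i * b $ i"
    using not_real_square_gt_zero by blast
  then show ?thesis
    unfolding scalar_prod_lessThan[OF assms(1)] using \<open>i < n\<close> by (intro sum_pos2[of _ i]) auto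
qed

lemma scalar_prod_mult_mat_vec_bound:
  fixes A :: "real Matrix.mat"
  assumes "A \<in> carrier_mat n n" "b \<in> carrier_vec n"
  shows "\<bar>b \<bullet> (A *\<^sub>v b)\<bar> \<le> (\<Sum>i<n. \<Sum>k<n. \<bar>A $$ (i, k)\<bar>) * (b \<bullet> b)"
proof -
  have coord: "\<bar>b $ i\<bar> * \<bar>b $ k\<bar> \<le> b \<bullet> b" if "i < n" "k < n" for i k
  proof -
    have le: "(b $ l)\<^sup>2 \<le> b \<bullet> b" if "l < n" for l
      unfolding scalar_prod_lessThan[OF assms(2)] power2_eq_square
      using that by (intro member_le_sum) auto
    have "2 * (\<bar>b $ i\<bar> * \<bar>b $ k\<bar>) \<le> (b $ i)\<^sup>2 + (b $ k)\<^sup>2"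
      using zero_le_power2[of "\<bar>b $ i\<bar> - \<bar>b $ k\<bar>"] by (simp add: power2_diff)
    then show ?thesis
      using le[OF that(1)] le[OF that(2)] by linarith
  qed
  have "b \<bullet> (A *\<^sub>v b) = (\<Sum>i<n. \<Sum>k<n. A $$ (i, k) * (b $ i * b $ k))"
    using assms mult_mat_vec_carrier[OF assms]
    by (simp add: scalar_prod_lessThan[of _ n] index_mult_mat_vec_sum sum_distrib_left mult_ac
        del: index_mult_mat_vec)
  also have "\<bar>\<dots>\<bar> \<le> (\<Sum>i<n. \<Sum>k<n. \<bar>A $$ (i, k) * (b $ i * b $ k)\<bar>)"
    by (rule order_trans[OF sum_abs sum_mono[OF sum_abs]])
  also have "\<dots> \<le> (\<Sum>i<n. \<Sum>k<n. \<bar>A $$ (i, k)\<bar> * (b \<bullet> b))"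
    using coord by (intro sum_mono) (auto simp: abs_mult intro!: mult_left_mono)
  finally show ?thesis
    by (simp add: sum_distrib_right)
qed

text \<open>The constant must not depend on \<open>b\<close>: the weights \<alpha> are fixed first,
  and \<open>b\<close> is then produced by the dimension count.\<close>

lemma hess_form_bounded:
  assumes "X \<in> sym_tuples n"
  shows "\<exists>K. \<forall>b\<in>carrier_vec n. hess_form n X p \<alpha> \<beta> b \<le> K * (b \<bullet> b)"
proof -
  define M where "M u = (\<Sum>i<n. \<Sum>k<n. \<bar>eval_word n X u $$ (i, k)\<bar>)" for u
  define K where "K = (\<Sum>w\<in>Poly_Mapping.keys p. \<bar>Poly_Mapping.lookup p w\<bar> *
    (\<Sum>(a, j, u, k, m)\<in>splits2 w. \<bar>\<alpha> j (rev a) * \<beta> k m\<bar> * M u))"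
  have "hess_form n X p \<alpha> \<beta> b \<le> K * (b \<bullet> b)" if b: "b \<in> carrier_vec n" for b
  proof -
    have M: "\<bar>b \<bullet> (eval_word n X u *\<^sub>v b)\<bar> \<le> M u * (b \<bullet> b)" for u
      unfolding M_def using assms b by (intro scalar_prod_mult_mat_vec_bound) simp_all
    have le: "c * s \<le> \<bar>c\<bar> * \<bar>s\<bar>" for c s :: real
      using abs_ge_self[of "c * s"] by (simp add: abs_mult)
    have "hess_form n X p \<alpha> \<beta> b \<le> (\<Sum>w\<in>Poly_Mapping.keys p. \<bar>Poly_Mapping.lookup p w\<bar> *
      \<bar>\<Sum>(a, j, u, k, m)\<in>splits2 w. \<alpha> j (rev a) * \<beta> k m * (b \<bullet> (eval_word n X u *\<^sub>v b))\<bar>)"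
      unfolding hess_form_def nc_ext_def real_scaleR_def by (intro sum_mono le)
    also have "\<dots> \<le> (\<Sum>w\<in>Poly_Mapping.keys p. \<bar>Poly_Mapping.lookup p w\<bar> *
      (\<Sum>(a, j, u, k, m)\<in>splits2 w. \<bar>\<alpha> j (rev a) * \<beta> k m\<bar> * (M u * (b \<bullet> b))))"
      unfolding case_prod_unfold
      by (intro sum_mono mult_left_mono order_trans[OF sum_abs])
        (auto simp: abs_mult intro!: mult_left_mono M)
    also have "\<dots> = K * (b \<bullet> b)"
      unfolding K_def case_prod_unfold sum_distrib_right sum_distrib_left by (simp add: mult_ac)
    finally show ?thesis .
  qed
  then show ?thesis by blast
qed

lemma hess_form_add_scale:
  "hess_form n X p (\<lambda>j m. \<alpha> j m + s * \<beta> j m) (\<lambda>j m. \<alpha> j m + s * \<beta> j m) b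
    = hess_form n X p \<alpha> \<alpha> b + s * (hess_form n X p \<alpha> \<beta> b + hess_form n X p \<beta> \<alpha> b)
      + s\<^sup>2 * hess_form n X p \<beta> \<beta> b"
  unfolding hess_form_def nc_ext_mult_fun[symmetric] nc_ext_add_fun[symmetric]
    case_prod_unfold sum_distrib_left sum.distrib[symmetric]
  by (intro nc_ext_cong sum.cong refl) (simp add: algebra_simps power2_eq_square)

text \<open>Inserted in both arguments of \<open>hess_form\<close>, such indicators extract a single
  block of the middle matrix of p''.\<close>

definition unit_index :: "'g \<Rightarrow> 'g list \<Rightarrow> 'g \<Rightarrow> 'g list \<Rightarrow> real" where
  "unit_index j0 m0 j m = (if j = j0 \<and> m = m0 then 1 else 0)"

text \<open>The degree bound leaves no letters between the two marked ones, so the block is a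
  multiple of the identity and \<open>X\<close> disappears.\<close>

lemma hess_form_unit_index:
  assumes "nc_degree p \<le> length m0 + length m1 + 2" and b: "b \<in> carrier_vec n"
  shows "hess_form n X p (unit_index j0 m0) (unit_index j1 m1) b
    = Poly_Mapping.lookup p (rev m0 @ j0 # j1 # m1) * (b \<bullet> b)"
proof -
  have "(\<Sum>(a, j, u, k, m)\<in>splits2 w. unit_index j0 m0 j (rev a) * unit_index j1 m1 k m * (b \<bullet> (eval_word n X u *\<^sub>v b)))
    = (if w = rev m0 @ j0 # j1 # m1 then b \<bullet> b else 0)" if "w \<in> Poly_Mapping.keys p" for w
  proof -
    have "length w \<le> length m0 + length m1 + 2"
      using that assms nc_degree_le_iff by metis
    then have "(\<Sum>(a, j, u, k, m)\<in>splits2 w. unit_index j0 m0 j (rev a) * unit_index j1 m1 k m * (b \<bullet> (eval_word n X u *\<^sub>v b)))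
      = (\<Sum>z\<in>splits2 w \<inter> {(rev m0, j0, [], j1, m1)}. b \<bullet> b)"
      using b by (intro sum.mono_neutral_cong_right[OF finite_splits2])
        (auto simp: splits2_def unit_index_def split: if_splits)
    also have "\<dots> = (if w = rev m0 @ j0 # j1 # m1 then b \<bullet> b else 0)"
      by (auto simp: splits2_def)
    finally show ?thesis .
  qed
  then have "hess_form n X p (unit_index j0 m0) (unit_index j1 m1) b
    = nc_ext (\<lambda>w. if w = rev m0 @ j0 # j1 # m1 then b \<bullet> b else 0) p"
    unfolding hess_form_def by (rule nc_ext_cong)
  then show ?thesis
    by (simp add: nc_ext_single_word)
qed

text \<open>A 2 by 2 argument: one diagonal block is zero and the off-diagonal ones are the nonzero
  scalar \<open>c\<close>, so a suitable multiple of the second direction outweighs the bounded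
  first diagonal term.\<close>

lemma hess_form_indefinite:
  fixes p :: "'g ncpoly"
  assumes X: "X \<in> sym_tuples n" and sym: "nc_symmetric p" and deg: "nc_degree p > 2"
  obtains \<alpha> where "\<And>j m. length m + 2 > nc_degree p \<Longrightarrow> \<alpha> j m = 0"
    "\<And>b. b \<in> carrier_vec n \<Longrightarrow> b \<noteq> 0\<^sub>v n \<Longrightarrow> hess_form n X p \<alpha> \<alpha> b < 0"
proof -
  obtain w where w: "w \<in> Poly_Mapping.keys p" "length w = nc_degree p"
    using ex_word_of_degree[of p] deg by auto
  obtain k0 j0 m0 where w_eq: "w = k0 # j0 # m0"
    using w(2) deg by (cases w; cases "tl w") auto
  define c where "c = Poly_Mapping.lookup p w"
  have c: "c \<noteq> 0"
    using w(1) by (simp add: c_def in_keys_iff)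
  have len: "nc_degree p = length m0 + 2"
    using w(2) by (simp add: w_eq)
  \<comment> \<open>Here degree above two is used: \<open>rev m0 @ j0 # j0 # m0\<close> is longer
    than the degree only if \<open>m0\<close> is nonempty.\<close>
  then have m0: "m0 \<noteq> []"
    using deg by auto
  define \<xi> \<tau> where "\<xi> = unit_index k0 []" and "\<tau> = unit_index j0 m0"
  obtain K where K: "\<And>b. b \<in> carrier_vec n \<Longrightarrow> hess_form n X p \<xi> \<xi> b \<le> K * (b \<bullet> b)"
    using hess_form_bounded[OF X] by metis
  \<comment> \<open>Makes the mixed terms equal to \<open>- (K + 1) * (b \<bullet> b)\<close>,
    against at most \<open>K * (b \<bullet> b)\<close> from the first diagonal term.\<close>
  define s where "s = - (K + 1) / (2 * c)"
  define \<alpha> where "\<alpha> j m = \<xi> j m + s * \<tau> j m" for j m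
  have neg: "hess_form n X p \<alpha> \<alpha> b < 0" if b: "b \<in> carrier_vec n" "b \<noteq> 0\<^sub>v n" for b
  proof -
    have "Poly_Mapping.lookup p (rev m0 @ j0 # j0 # m0) = 0"
      using len m0 by (intro lookup_eq_0_above_degree) (cases m0, auto)
    \<comment> \<open>The second mixed block belongs to the reversed word of \<open>w\<close>;
      symmetry of \<open>p\<close> gives it the same coefficient.\<close>
    moreover have "Poly_Mapping.lookup p (rev m0 @ [j0, k0]) = c"
      using nc_symmetricD[OF sym, of w] by (simp add: c_def w_eq)
    ultimately have "hess_form n X p \<xi> \<tau> b = c * (b \<bullet> b)" "hess_form n X p \<tau> \<xi> b = c * (b \<bullet> b)"
      "hess_form n X p \<tau> \<tau> b = 0"
      using len b by (simp_all add: \<xi>_def \<tau>_def hess_form_unit_index c_def w_eq)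
    then have "hess_form n X p \<alpha> \<alpha> b = hess_form n X p \<xi> \<xi> b + s * (2 * c * (b \<bullet> b))"
      by (simp add: \<alpha>_def[abs_def] hess_form_add_scale)
    also have "s * (2 * c * (b \<bullet> b)) = - (K + 1) * (b \<bullet> b)"
      using c by (simp add: s_def field_simps)
    finally show ?thesis
      using K[OF b(1)] scalar_prod_self_pos[OF b] by (simp add: algebra_simps)
  qed
  moreover have "\<alpha> j m = 0" if "length m + 2 > nc_degree p" for j m
    using that len by (auto simp: \<alpha>_def \<xi>_def \<tau>_def unit_index_def)
  ultimately show ?thesis
    using that by blast
qed

section \<open>Polynomials of degree at most two\<close>

text \<open>Reduces everything of second order to the quadratic coefficients:
  \<open>hess_form\<close>, \<open>word_deriv2\<close> and the convexity defect all vanish on words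
  of length at most one.\<close>

lemma nc_ext_degree_2:
  fixes p :: "'g::finite ncpoly"
  assumes deg: "nc_degree p \<le> 2" and f: "f [] = 0" "\<And>j. f [j] = 0"
  shows "nc_ext f p = (\<Sum>j\<in>UNIV. \<Sum>k\<in>UNIV. Poly_Mapping.lookup p [j, k] *\<^sub>R f [j, k])"
proof -
  define B where "B = (\<lambda>(j, k). [j, k]) ` (UNIV :: ('g \<times> 'g) set)"
  have inj: "inj (\<lambda>(j :: 'g, k :: 'g). [j, k])"
    by (auto simp: inj_on_def)
  have "nc_ext f p = (\<Sum>w\<in>Poly_Mapping.keys p \<union> B. Poly_Mapping.lookup p w *\<^sub>R f w)"
    by (rule nc_ext_superset) (auto simp: B_def)
  also have "\<dots> = (\<Sum>w\<in>B. Poly_Mapping.lookup p w *\<^sub>R f w)"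
  proof (rule sum.mono_neutral_right)
    show "\<forall>w\<in>Poly_Mapping.keys p \<union> B - B. Poly_Mapping.lookup p w *\<^sub>R f w = 0"
    proof
      fix w assume w: "w \<in> Poly_Mapping.keys p \<union> B - B"
      then have "length w \<le> 2"
        using deg nc_degree_le_iff by blast
      then consider "w = []" | j where "w = [j]" | j k where "w = [j, k]"
        by (cases w; cases "tl w"; cases "tl (tl w)") auto
      then show "Poly_Mapping.lookup p w *\<^sub>R f w = 0"
        using w f by cases (auto simp: B_def)
    qed
  qed (auto simp: B_def)
  also have "\<dots> = (\<Sum>(j, k)\<in>UNIV. Poly_Mapping.lookup p [j, k] *\<^sub>R f [j, k])"
    unfolding B_def sum.reindex[OF inj] by (intro sum.cong) auto
  finally show ?thesis
    by (simp add: sum.cartesian_product UNIV_Times_UNIV)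
qed

text \<open>The two marked letters exhaust the word, so no entry of \<open>X\<close>
  survives.\<close>

lemma hess_form_degree_2:
  fixes p :: "'g::finite ncpoly"
  assumes "nc_degree p \<le> 2" "b \<in> carrier_vec n"
  shows "hess_form n X p (\<lambda>j m. if m = [] then x j else 0) (\<lambda>j m. if m = [] then x j else 0) b
    = (\<Sum>j\<in>UNIV. \<Sum>k\<in>UNIV. Poly_Mapping.lookup p [j, k] * x j * x k) * (b \<bullet> b)"
  unfolding hess_form_def using assms
  by (subst nc_ext_degree_2) (simp_all add: splits1_Cons splits2_Cons sum_distrib_left mult_ac)

text \<open>The Hessian has constant coefficients here, so a sum-of-squares form of the coefficient
  matrix yields squares of linear forms in the \<open>h\<close>-variables.\<close>

lemma sigma_minus_min_hessian_degree_2: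
  fixes p :: "'g::finite ncpoly"
  assumes deg: "nc_degree p \<le> 2" and sym: "nc_symmetric p"
    and psd: "\<And>x. (\<Sum>j\<in>UNIV. \<Sum>k\<in>UNIV. Poly_Mapping.lookup p [j, k] * x j * x k) \<ge> 0"
  shows "sigma_minus_min (nc_hessian p) = 0"
proof -
  obtain cs where cs: "\<And>j k. Poly_Mapping.lookup p [j, k] = (\<Sum>c\<leftarrow>cs. c j * c k)"
    using psd_form_eq_sum_squares[of UNIV "\<lambda>j k. Poly_Mapping.lookup p [j, k]", OF _ _ psd]
      nc_symmetricD[OF sym, of "[_, _]"] by auto
  \<comment> \<open>The factor \<open>sqrt 2\<close> absorbs the 2 of the second derivative.\<close>
  define q :: "('g \<Rightarrow> real) \<Rightarrow> ('g + 'g) ncpoly"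
    where "q c = (\<Sum>j\<in>UNIV. (sqrt 2 * c j) *\<^sub>R nc_word [Inr j])" for c
  have q: "nc_adj (q c) * q c = 2 *\<^sub>R (\<Sum>j\<in>UNIV. \<Sum>k\<in>UNIV. (c j * c k) *\<^sub>R nc_word [Inr j, Inr k])" for c
    by (simp add: q_def linear_sum[OF linear_nc_adj] linear_scale[OF linear_nc_adj] sum_product
        scaleR_mult_ncpoly nc_word_mult scaleR_sum_right mult_ac)
  have "nc_hessian p = 2 *\<^sub>R (\<Sum>j\<in>UNIV. \<Sum>k\<in>UNIV. (\<Sum>c\<leftarrow>cs. c j * c k) *\<^sub>R nc_word [Inr j, Inr k])"
    unfolding nc_hessian_eq cs[symmetric]
    by (subst nc_ext_degree_2[OF deg]) (simp_all add: word_deriv2_Cons word_deriv_Cons nc_word_mult)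
  also have "\<dots> = (\<Sum>q\<leftarrow>map q cs. nc_adj q * q)"
    by (induction cs) (simp_all add: q scaleR_add_left sum.distrib scaleR_add_right)
  finally have "sos_difference (nc_hessian p) (map q cs) []"
    by (simp add: sos_difference_def)
  then show ?thesis
    unfolding sigma_minus_min_def by (intro Least_eq_0) auto
qed

section \<open>Convexity in degree at most two\<close>

lemma sym_tuples_convex_combination:
  "X \<in> sym_tuples n \<Longrightarrow> Y \<in> sym_tuples n \<Longrightarrow> (\<lambda>j. t \<cdot>\<^sub>m X j + (1 - t) \<cdot>\<^sub>m Y j) \<in> sym_tuples n"
  by (auto simp: sym_tuples_def transpose_add[of _ n n] transpose_mat_smult)

text \<open>The convexity defect at \<open>u\<close> is \<open>t * (1 - t)\<close> times the
  quadratic part applied to the vectors \<open>(X j - Y j) *\<^sub>v u\<close>. Summed coordinate by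
  coordinate, it is a sum of values of the nonnegative scalar form.\<close>

lemma nc_convex_degree_2:
  fixes p :: "'g::finite ncpoly"
  assumes deg: "nc_degree p \<le> 2"
    and psd: "\<And>x. (\<Sum>j\<in>UNIV. \<Sum>k\<in>UNIV. Poly_Mapping.lookup p [j, k] * x j * x k) \<ge> 0"
  shows "nc_convex p"
  unfolding nc_convex_def loewner_le_def
proof (intro allI ballI)
  fix n :: nat and X Y :: "'g \<Rightarrow> real Matrix.mat" and t :: real and u :: "real Matrix.vec"
  assume X: "X \<in> sym_tuples n" and Y: "Y \<in> sym_tuples n" and t: "t \<in> {0..1}" and u: "u \<in> carrier_vec n"
  define Z where "Z j = t \<cdot>\<^sub>m X j + (1 - t) \<cdot>\<^sub>m Y j" for j
  have Z: "Z \<in> sym_tuples n"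
    unfolding Z_def[abs_def] by (rule sym_tuples_convex_combination[OF X Y])
  have Wu: "W j *\<^sub>v u \<in> carrier_vec n" if "W \<in> sym_tuples n" for W :: "'g \<Rightarrow> real Matrix.mat" and j
    using that u by (intro mult_mat_vec_carrier[of _ n n]) (auto dest: sym_tuplesD)
  define x y where "x j i = (X j *\<^sub>v u) $ i" and "y j i = (Y j *\<^sub>v u) $ i" for j i
  have z: "(Z j *\<^sub>v u) $ i = t * x j i + (1 - t) * y j i" if "i < n" for j i
    using that u sym_tuplesD(1)[OF X, of j] sym_tuplesD(1)[OF Y, of j] sym_tuplesD(1)[OF Z, of j]
    by (simp add: x_def y_def index_mult_mat_vec_sum[of _ n] Z_def sum_distrib_left sum.distrib distrib_right mult.assoc
        del: index_mult_mat_vec)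
  define F where "F W w = (eval_word n W w *\<^sub>v u) \<bullet> u" for W :: "'g \<Rightarrow> real Matrix.mat" and w
  have F1: "F W [j] = (\<Sum>i<n. (W j *\<^sub>v u) $ i * u $ i)" if "W \<in> sym_tuples n" for W j
    using u right_mult_one_mat[OF sym_tuplesD(1)[OF that, of j]]
    by (simp add: F_def scalar_prod_lessThan[of _ n] del: index_mult_mat_vec)
  have F2: "F W [j, k] = (\<Sum>i<n. (W k *\<^sub>v u) $ i * (W j *\<^sub>v u) $ i)" if "W \<in> sym_tuples n" for W j k
  proof -
    have "F W [j, k] = (eval_word n W (rev [j]) *\<^sub>v (W k *\<^sub>v u)) \<bullet> u"
      unfolding F_def using that u Wu by (simp add: eval_word_Cons_mult_vec del: eval_word_Cons)
    also have "\<dots> = (W k *\<^sub>v u) \<bullet> (W j *\<^sub>v u)"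
      by (subst scalar_prod_eval_word_rev[OF that Wu[OF that] u])
        (simp add: right_mult_one_mat[OF sym_tuplesD(1)[OF that]])
    finally show ?thesis
      by (simp add: scalar_prod_lessThan[OF Wu[OF that]])
  qed
  \<comment> \<open>The convexity defect of a single word; it vanishes on words of length at most
    one, which are affine in the matrices.\<close>
  define G where "G w = t * F X w + (1 - t) * F Y w - F Z w" for w
  have G0: "G [] = 0"
    using u by (simp add: G_def F_def algebra_simps)
  have G1: "G [j] = 0" for j
    by (simp add: G_def F1 X Y Z z sum_distrib_left flip: x_def y_def
        del: index_mult_mat_vec) (simp add: algebra_simps sum.distrib sum_subtractf)
  have G2: "G [j, k] = t * (1 - t) * (\<Sum>i<n. (x j i - y j i) * (x k i - y k i))" for j k
    by (simp add: G_def F2 X Y Z z sum_distrib_left flip: x_def y_def sum.distrib sum_subtractf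
        del: index_mult_mat_vec) (simp add: algebra_simps)
  have quad: "(M *\<^sub>v u) \<bullet> u = (\<Sum>i<n. \<Sum>k<n. M $$ (i, k) * u $ k * u $ i)" if "M \<in> carrier_mat n n" for M
    using that u by (simp add: scalar_prod_lessThan[of _ n] index_mult_mat_vec_sum sum_distrib_right
        del: index_mult_mat_vec)
  have ev: "nc_eval n W p \<in> carrier_mat n n" for W
    by (simp add: nc_eval_def)
  have "((t \<cdot>\<^sub>m nc_eval n X p + (1 - t) \<cdot>\<^sub>m nc_eval n Y p - nc_eval n Z p) *\<^sub>v u) \<bullet> u
    = t * ((nc_eval n X p *\<^sub>v u) \<bullet> u) + (1 - t) * ((nc_eval n Y p *\<^sub>v u) \<bullet> u) - (nc_eval n Z p *\<^sub>v u) \<bullet> u"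
    using ev carrier_matD[OF ev]
    by (simp add: quad minus_carrier_mat sum_distrib_left flip: sum.distrib sum_subtractf)
      (simp add: algebra_simps)
  also have "\<dots> = nc_ext G p"
    unfolding G_def[abs_def] nc_ext_diff_fun nc_ext_add_fun nc_ext_mult_fun F_def
    by (simp only: nc_eval_quadratic_form[OF X u] nc_eval_quadratic_form[OF Y u] nc_eval_quadratic_form[OF Z u])
  also have "\<dots> = (\<Sum>j\<in>UNIV. \<Sum>k\<in>UNIV. \<Sum>i<n.
      t * (1 - t) * (Poly_Mapping.lookup p [j, k] * (x j i - y j i) * (x k i - y k i)))"
    by (subst nc_ext_degree_2[OF deg G0 G1]) (simp add: G2 sum_distrib_left mult_ac)
  also have "\<dots> = (\<Sum>i<n. t * (1 - t) * (\<Sum>j\<in>UNIV. \<Sum>k\<in>UNIV.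
      Poly_Mapping.lookup p [j, k] * (x j i - y j i) * (x k i - y k i)))"
    unfolding sum_distrib_left by (subst (2) sum.swap, subst sum.swap) (rule refl)
  also have "\<dots> \<ge> 0"
    using t by (intro sum_nonneg mult_nonneg_nonneg psd) auto
  finally show "((t \<cdot>\<^sub>m nc_eval n X p + (1 - t) \<cdot>\<^sub>m nc_eval n Y p
      - nc_eval n (\<lambda>j. t \<cdot>\<^sub>m X j + (1 - t) \<cdot>\<^sub>m Y j) p) *\<^sub>v u) \<bullet> u \<ge> 0"
    by (simp add: Z_def[abs_def])
qed

theorem theorem1p5:
  fixes p :: "'g::finite ncpoly"
    and X :: "'g \<Rightarrow> real Matrix.mat"
    and v :: "real Matrix.vec"
    and n d \<nu> :: nat
  assumes "nc_symmetric p"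
    and "nc_degree p = d"
    and "\<nu> = (\<Sum>i<d. CARD('g) ^ i)"
    and "X \<in> sym_tuples n"
    and "v \<in> carrier_vec n"
    and "int (n * CARD('g) * \<nu>) - int (Real_Vector_Spaces.dim {Vt_vec n d X H v | H. H \<in> sym_tuples n})
           \<le> int n - 1"
    and "relaxed_hessian_positive n p X v"
  shows "sigma_minus_min (nc_hessian p) = 0 \<and> nc_convex p \<and> nc_degree p \<le> 2"
proof -
  note sym = assms(1) and X = assms(4) and v = assms(5)
  \<comment> \<open>The integer inequality is turned into a strict one between naturals, without
    subtraction.\<close>
  have codim: "n * (CARD('g) * (\<Sum>i<nc_degree p. CARD('g) ^ i))
      < dim {Vt_vec n (nc_degree p) X H v | H. H \<in> sym_tuples n} + n"
  proof -
    have "int (n * CARD('g) * \<nu>) < int (dim {Vt_vec n d X H v | H. H \<in> sym_tuples n} + n)"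
      using assms(6) by linarith
    then show ?thesis
      unfolding of_nat_less_iff by (simp add: assms(2,3) mult.assoc)
  qed
  note somewhere = hess_form_nonneg_somewhere[OF X v codim assms(7)]
  have deg: "nc_degree p \<le> 2"
  proof (rule ccontr)
    assume "\<not> ?thesis"
    then have deg: "nc_degree p > 2" by simp
    from hess_form_indefinite[OF X sym deg] obtain \<alpha> where
      \<alpha>: "\<And>j m. length m + 2 > nc_degree p \<Longrightarrow> \<alpha> j m = 0"
      "\<And>b. b \<in> carrier_vec n \<Longrightarrow> b \<noteq> 0\<^sub>v n \<Longrightarrow> hess_form n X p \<alpha> \<alpha> b < 0" by metis
    from somewhere[of \<alpha>] deg \<alpha>(1) obtain b where
      "b \<in> carrier_vec n" "b \<noteq> 0\<^sub>v n" "hess_form n X p \<alpha> \<alpha> b \<ge> 0" by force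
    then show False
      using \<alpha>(2) by force
  qed
  \<comment> \<open>In degree two, weights supported on the empty word are admissible, and the
    positive factor \<open>b \<bullet> b\<close> can be cancelled. In lower degree there are no
    quadratic coefficients.\<close>
  have psd: "(\<Sum>j\<in>UNIV. \<Sum>k\<in>UNIV. Poly_Mapping.lookup p [j, k] * x j * x k) \<ge> 0" for x
  proof (cases "nc_degree p = 2")
    case True
    define \<alpha> where "\<alpha> j m = (if m = [] then x j else 0)" for j and m :: "'g list"
    have "\<exists>b\<in>carrier_vec n. b \<noteq> 0\<^sub>v n \<and> hess_form n X p \<alpha> \<alpha> b \<ge> 0"
      using True by (intro somewhere) (auto simp: \<alpha>_def)
    then obtain b where b: "b \<in> carrier_vec n" "b \<noteq> 0\<^sub>v n" "hess_form n X p \<alpha> \<alpha> b \<ge> 0"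
      by blast
    then show ?thesis
      using scalar_prod_self_pos[OF b(1,2)]
      by (simp add: \<alpha>_def[abs_def] hess_form_degree_2[OF deg b(1)] zero_le_mult_iff)
  next
    case False
    then have "Poly_Mapping.lookup p [j, k] = 0" for j k
      using deg by (intro lookup_eq_0_above_degree) simp
    then show ?thesis by simp
  qed
  show ?thesis
    using sigma_minus_min_hessian_degree_2[OF deg sym psd] nc_convex_degree_2[OF deg psd] deg by blast
qed

end
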